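(* Let $P$ be a finite poset with at least two elements, and assume that $P$ is irreducible with respect to ordinal sum. Let $L(P)$ be the distributive lattice of poset ideals of $P$, let $\Bbbk$ be a field, and let $\mathcal{F}_{L(P)}$ and $\mathcal{R}(L(P))=\Bbbk[\mathcal{F}_{L(P)}]$ be the set of binomials and the subalgebra associated with $L(P)$. Then the following conditions are equivalent: (1) $\mathcal{F}_{L(P)}$ forms a Khovanskii basis of $\mathcal{R}(L(P))$ with respect to a (i.e. some) compatible monomial order; (2) $P$ is $\{(2+2),(1+1+1)\}$-free; (3) $L(P)$ is (isomorphic to) a generalized snake poset.
   Context: **Posets and lattices.** For a finite poset $P$, a poset ideal is a subset $\alpha\subseteq P$ such that $a\in\alpha$, $b\in P$, $b\le_P a$ imply $b\in\alpha$. $L(P)$ is the set of all poset ideals of $P$ (including $\emptyset$ and $P$), ordered by inclusion; it is a finite distributive lattice with $\alpha\wedge\beta=\alpha\cap\beta$ and $\alpha\vee\beta=\alpha\cup\beta$. The ordinal sum $P\oplus Q$ of posets $P,Q$ is the poset on the disjoint union $P\cup Q$ with $a\le b$ iff (i) $a,b\in P$ and $a\le_P b$, (ii) $a,b\in Q$ and $a\le_Q b$, or (iii) $a\in P$ and $b\in Q$. $P$ is irreducible with respect to ordinal sum if it cannot be written as the ordinal sum of two proper (nonempty) subposets of $P$. Subposets carry the induced order. The poset $(2+2)$ is the disjoint union of two $2$-element chains (elements of different chains being incomparable); $(1+1+1)$ is the $3$-element antichain. $P$ is $\{(2+2),(1+1+1)\}$-free if it contains no subposet isomorphic to $(2+2)$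 and none isomorphic to $(1+1+1)$. **Generalized snake posets.** A generalized snake word is a word $\mathbf{w}=w_0w_1\cdots w_l$ with $l\ge 0$, $w_0=\epsilon$ the empty letter, and $w_i\in\{L,R\}$ for $1\le i\le l$. The generalized snake poset $P(\mathbf{w})$ is defined recursively ($\lessdot$ denotes the cover relation): - $P(\epsilon)$ is the poset on $\{\alpha_0,\alpha_1,\alpha_2,\alpha_3\}$ with cover relations $\alpha_0\lessdot\alpha_1$, $\alpha_0\lessdot\alpha_2$, $\alpha_1\lessdot\alpha_3$, $\alpha_2\lessdot\alpha_3$. - $P(w_0\cdots w_l)$ is $P(w_0\cdots w_{l-1})\cup\{\alpha_{2l+2},\alpha_{2l+3}\}$ with the added cover relations $\alpha_{2l+1}\lessdot\alpha_{2l+3}$, $\alpha_{2l+2}\lessdot\alpha_{2l+3}$, and: $\alpha_{2l-1}\lessdot\alpha_{2l+2}$ if ($l=1$ and $w_l=L$) or ($l\ge2$ and $w_{l-1}w_l\in\{RL,LR\}$); $\alpha_{2l}\lessdot\alpha_{2l+2}$ if ($l=1$ and $w_l=R$) or ($l\ge 2$ and $w_{l-1}w_l\in\{LL,RR\}$). A generalized snake poset is a poset of the form $P(\mathbf{w})$ for some generalized snake word $\mathbf{w}$. **Algebra.** Let $S=\Bbbk[x_\alpha\mid\alpha\in L(P)]$ be the polynomial ring. For incomparable $\alpha,\beta\in L(P)$ put $f_{\alpha,\beta}=x_\alpha x_\beta-x_{\alpha\wedge\beta}x_{\alpha\vee\beta}$. Let $\mathcal{F}_{L(P)}=\{f_{\alpha,\beta}\mid\alpha,\beta\in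 L(P)\text{ incomparable}\}$ and let $\mathcal{R}(L(P))=\Bbbk[\mathcal{F}_{L(P)}]\subset S$ be the $\Bbbk$-subalgebra it generates. A monomial order on $S$ is a total order on monomials, compatible with multiplication, with $1$ the least monomial; $\operatorname{in}_\preceq(f)$ is the largest term of $f$. A monomial order $\preceq$ is compatible if $\operatorname{in}_\preceq(f_{\alpha,\beta})=x_\alpha x_\beta$ for all incomparable $\alpha,\beta\in L(P)$. For a subalgebra $R\subset S$, the initial algebra $\operatorname{in}_\preceq(R)$ is the $\Bbbk$-span of $\{\operatorname{in}_\preceq(f)\mid f\in R,\ f\ne0\}$. A subset $\mathcal{F}\subset R$ is a Khovanskii basis (equivalently, SAGBI basis) of $R$ with respect to $\preceq$ if $\{\operatorname{in}_\preceq(f)\mid f\in\mathcal{F}\}$ generates $\operatorname{in}_\preceq(R)$ as a $\Bbbk$-algebra. *)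

theory Defs
  imports Complex_Main "HOL-Library.Poly_Mapping"
begin

section \<open>Finite posets\<close>

text \<open>
  A poset is a carrier \<open>A\<close> together with a reflexive order relation \<open>r\<close> such that
  \<open>partial_order_on A r\<close>; a subset \<open>B\<close> of \<open>A\<close> carries the induced order \<open>Restr r B\<close>.
\<close>

definition poset_iso :: "'a set \<Rightarrow> 'a rel \<Rightarrow> 'b set \<Rightarrow> 'b rel \<Rightarrow> bool" where
  "poset_iso A r B s \<longleftrightarrow>
     (\<exists>f. bij_betw f A B \<and> (\<forall>x\<in>A. \<forall>y\<in>A. (x, y) \<in> r \<longleftrightarrow> (f x, f y) \<in> s))"

definition poset_ideals :: "'a set \<Rightarrow> 'a rel \<Rightarrow> 'a set set" where
  "poset_ideals A r = {\<alpha>. \<alpha> \<subseteq> A \<and> (\<forall>a\<in>\<alpha>. \<forall>b\<in>A. (b, a) \<in> r \<longrightarrow> b \<in> \<alpha>)}"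

text \<open>The order on the ordinal sum of two posets with disjoint carriers \<open>B\<close> and \<open>C\<close>.\<close>

definition ordinal_sum :: "'a set \<Rightarrow> 'a rel \<Rightarrow> 'a set \<Rightarrow> 'a rel \<Rightarrow> 'a rel" where
  "ordinal_sum B r C s = r \<union> s \<union> B \<times> C"

definition ordinal_irreducible :: "'a set \<Rightarrow> 'a rel \<Rightarrow> bool" where
  "ordinal_irreducible A r \<longleftrightarrow>
     \<not> (\<exists>B C. B \<noteq> {} \<and> C \<noteq> {} \<and> B \<inter> C = {} \<and> B \<union> C = A \<and>
          r = ordinal_sum B (Restr r B) C (Restr r C))"

definition poset_free :: "'a set \<Rightarrow> 'a rel \<Rightarrow> 'b set \<Rightarrow> 'b rel \<Rightarrow> bool" where
  "poset_free A r Q q \<longleftrightarrow> \<not> (\<exists>B\<subseteq>A. poset_iso B (Restr r B) Q q)"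

text \<open>
  The poset \<open>(2+2)\<close> has carrier \<open>{0,1,2,3}\<close> and consists of the chains \<open>0 < 1\<close> and \<open>2 < 3\<close>;
  the poset \<open>(1+1+1)\<close> is the antichain on \<open>{0,1,2}\<close>.
\<close>

definition two_plus_two :: "nat rel" where
  "two_plus_two = Id_on {0, 1, 2, 3} \<union> {(0, 1), (2, 3)}"

definition one_plus_one_plus_one :: "nat rel" where
  "one_plus_one_plus_one = Id_on {0, 1, 2}"

definition free_2p2_1p1p1 :: "'a set \<Rightarrow> 'a rel \<Rightarrow> bool" where
  "free_2p2_1p1p1 A r \<longleftrightarrow>
     poset_free A r {0, 1, 2, 3} two_plus_two \<and>
     poset_free A r {0, 1, 2} one_plus_one_plus_one"


section \<open>Generalized snake posets\<close>

datatype snake_letter = sL | sR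

text \<open>
  A generalized snake word \<open>w\<^sub>0 w\<^sub>1 \<dots> w\<^sub>l\<close> (with \<open>w\<^sub>0\<close> empty) is the list of its letters
  \<open>w\<^sub>1, \<dots>, w\<^sub>l\<close>, so that \<open>w\<^sub>i\<close> is the list entry with index \<open>i - 1\<close>.
  The element \<open>\<alpha>\<^sub>i\<close> of the generalized snake poset is the natural number \<open>i\<close>.
\<close>

definition snake_char :: "snake_letter list \<Rightarrow> nat \<Rightarrow> snake_letter" where
  "snake_char w i = w ! (i - 1)"

text \<open>The cover relations added in passing from \<open>P(w\<^sub>0 \<dots> w\<^sub>l\<^sub>-\<^sub>1)\<close> to \<open>P(w\<^sub>0 \<dots> w\<^sub>l)\<close>, for \<open>l \<ge> 1\<close>.\<close>

definition snake_new_covers :: "snake_letter list \<Rightarrow> nat \<Rightarrow> nat rel" where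
  "snake_new_covers w l =
     {(2*l+1, 2*l+3), (2*l+2, 2*l+3)} \<union>
     (if l = 1 \<and> snake_char w l = sL \<or>
         l \<ge> 2 \<and> (snake_char w (l-1), snake_char w l) \<in> {(sR, sL), (sL, sR)}
      then {(2*l-1, 2*l+2)} else {}) \<union>
     (if l = 1 \<and> snake_char w l = sR \<or>
         l \<ge> 2 \<and> (snake_char w (l-1), snake_char w l) \<in> {(sL, sL), (sR, sR)}
      then {(2*l, 2*l+2)} else {})"

text \<open>\<open>snake_covers w k\<close> is the cover relation of \<open>P(w\<^sub>0 \<dots> w\<^sub>k)\<close>.\<close>

primrec snake_covers :: "snake_letter list \<Rightarrow> nat \<Rightarrow> nat rel" where
  "snake_covers w 0 = {(0, 1), (0, 2), (1, 3), (2, 3)}"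
| "snake_covers w (Suc k) = snake_covers w k \<union> snake_new_covers w (Suc k)"

definition snake_carrier :: "snake_letter list \<Rightarrow> nat set" where
  "snake_carrier w = {0..2 * length w + 3}"

definition snake_order :: "snake_letter list \<Rightarrow> nat rel" where
  "snake_order w = Restr ((snake_covers w (length w))\<^sup>*) (snake_carrier w)"

definition is_generalized_snake :: "'a set \<Rightarrow> 'a rel \<Rightarrow> bool" where
  "is_generalized_snake A r \<longleftrightarrow> (\<exists>w. poset_iso A r (snake_carrier w) (snake_order w))"


section \<open>Polynomials, monomial orders and Khovanskii bases\<close>

text \<open>
  Monomials are exponent functions of finite support (so products of monomials are sums of
  exponents and the monomial \<open>1\<close> is \<open>0\<close>), and polynomials are finitely supported functions
  from monomials to coefficients, multiplied by convolution.
\<close>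

type_synonym ('v, 'k) mpoly = "('v \<Rightarrow>\<^sub>0 nat) \<Rightarrow>\<^sub>0 'k"

definition mvar :: "'v \<Rightarrow> ('v, 'k::field) mpoly" where
  "mvar v = Poly_Mapping.single (Poly_Mapping.single v 1) 1"

definition mscale :: "'k::field \<Rightarrow> ('v, 'k) mpoly \<Rightarrow> ('v, 'k) mpoly" where
  "mscale c p = Poly_Mapping.single 0 c * p"

lemma vector_space_mscale: "vector_space (mscale :: 'k::field \<Rightarrow> ('v, 'k) mpoly \<Rightarrow> _)"
  unfolding vector_space_def mscale_def
  by (simp add: distrib_left distrib_right single_add mult_single flip: mult.assoc)

definition is_subalgebra :: "('v, 'k::field) mpoly set \<Rightarrow> bool" where
  "is_subalgebra R \<longleftrightarrow>
     (\<forall>c. Poly_Mapping.single 0 c \<in> R) \<and>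
     (\<forall>p\<in>R. \<forall>q\<in>R. p + q \<in> R) \<and> (\<forall>p\<in>R. \<forall>q\<in>R. p * q \<in> R)"

text \<open>
  The type of polynomials has a variable for every element of \<open>'v\<close>. The subalgebra generated
  by polynomials in the variables from a set \<open>V\<close> consists of polynomials in these variables, so
  it does not matter whether it is formed in \<open>\<Bbbk>[x\<^sub>v | v \<in> V]\<close> or in the full type.
\<close>

definition subalgebra_generated :: "('v, 'k::field) mpoly set \<Rightarrow> ('v, 'k) mpoly set" where
  "subalgebra_generated F = is_subalgebra hull F"

definition monomials_in :: "'v set \<Rightarrow> ('v \<Rightarrow>\<^sub>0 nat) set" where
  "monomials_in V = {m. Poly_Mapping.keys m \<subseteq> V}"

definition monomial_order :: "'v set \<Rightarrow> ('v \<Rightarrow>\<^sub>0 nat) rel \<Rightarrow> bool" where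
  "monomial_order V ord \<longleftrightarrow>
     linear_order_on (monomials_in V) ord \<and>
     (\<forall>m\<in>monomials_in V. (0, m) \<in> ord) \<and>
     (\<forall>u\<in>monomials_in V. \<forall>v\<in>monomials_in V. \<forall>m\<in>monomials_in V.
        (u, v) \<in> ord \<longrightarrow> (u + m, v + m) \<in> ord)"

text \<open>
  The largest monomial with nonzero coefficient and the largest term (including its coefficient);
  for a nonzero polynomial in the variables on whose monomials \<open>ord\<close> is a linear order these are
  well defined. The initial term of \<open>0\<close> comes out as \<open>0\<close>.
\<close>

definition leading_monomial :: "('v \<Rightarrow>\<^sub>0 nat) rel \<Rightarrow> ('v, 'k::field) mpoly \<Rightarrow> 'v \<Rightarrow>\<^sub>0 nat" where
  "leading_monomial ord p =
     (THE m. m \<in> Poly_Mapping.keys p \<and> (\<forall>m'\<in>Poly_Mapping.keys p. (m', m) \<in> ord))"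

definition initial_term :: "('v \<Rightarrow>\<^sub>0 nat) rel \<Rightarrow> ('v, 'k::field) mpoly \<Rightarrow> ('v, 'k) mpoly" where
  "initial_term ord p =
     Poly_Mapping.single (leading_monomial ord p) (Poly_Mapping.lookup p (leading_monomial ord p))"

definition initial_algebra :: "('v \<Rightarrow>\<^sub>0 nat) rel \<Rightarrow> ('v, 'k::field) mpoly set \<Rightarrow> ('v, 'k) mpoly set" where
  "initial_algebra ord R = module.span mscale {initial_term ord f | f. f \<in> R \<and> f \<noteq> 0}"

definition khovanskii_basis ::
    "('v \<Rightarrow>\<^sub>0 nat) rel \<Rightarrow> ('v, 'k::field) mpoly set \<Rightarrow> ('v, 'k) mpoly set \<Rightarrow> bool" where
  "khovanskii_basis ord R F \<longleftrightarrow>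
     F \<subseteq> R \<and> subalgebra_generated {initial_term ord f | f. f \<in> F} = initial_algebra ord R"


section \<open>The binomials of a lattice of sets\<close>

text \<open>
  Here \<open>L\<close> is a set of sets ordered by inclusion and closed under intersection and union (such as
  the lattice of poset ideals), so that meet and join are intersection and union.
\<close>

definition incomparable :: "'a set \<Rightarrow> 'a set \<Rightarrow> bool" where
  "incomparable \<alpha> \<beta> \<longleftrightarrow> \<not> \<alpha> \<subseteq> \<beta> \<and> \<not> \<beta> \<subseteq> \<alpha>"

definition lattice_binomial :: "'a set \<Rightarrow> 'a set \<Rightarrow> ('a set, 'k::field) mpoly" where
  "lattice_binomial \<alpha> \<beta> = mvar \<alpha> * mvar \<beta> - mvar (\<alpha> \<inter> \<beta>) * mvar (\<alpha> \<union> \<beta>)"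

definition lattice_binomials :: "'a set set \<Rightarrow> ('a set, 'k::field) mpoly set" where
  "lattice_binomials L = {lattice_binomial \<alpha> \<beta> | \<alpha> \<beta>. \<alpha> \<in> L \<and> \<beta> \<in> L \<and> incomparable \<alpha> \<beta>}"

definition lattice_algebra :: "'a set set \<Rightarrow> ('a set, 'k::field) mpoly set" where
  "lattice_algebra L = subalgebra_generated (lattice_binomials L)"

text \<open>The type argument fixes the coefficient field.\<close>

definition compatible_order :: "'k::field itself \<Rightarrow> 'a set set \<Rightarrow> ('a set \<Rightarrow>\<^sub>0 nat) rel \<Rightarrow> bool" where
  "compatible_order K L ord \<longleftrightarrow>
     monomial_order L ord \<and>
     (\<forall>\<alpha>\<in>L. \<forall>\<beta>\<in>L. incomparable \<alpha> \<beta> \<longrightarrow>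
        initial_term ord (lattice_binomial \<alpha> \<beta> :: ('a set, 'k) mpoly) = mvar \<alpha> * mvar \<beta>)"

end

theory Submission
  imports Defs
begin

text \<open>
  The proof goes round the cycle (2) \<open>\<Longrightarrow>\<close> (3) \<open>\<Longrightarrow>\<close> (1) \<open>\<Longrightarrow>\<close> (2), and the property of the
  lattice \<open>L\<close> that links the combinatorics with the algebra is that \<open>L\<close> has width two: no three
  elements are pairwise incomparable.

  From (2) to (3) (\<open>ideals_snake_embedding\<close>). An irreducible free poset with at least two elements
  has two maximal elements, and one of them, \<open>m\<close>, is above everything except the other, \<open>m'\<close>.
  Removing \<open>m\<close> keeps the poset irreducible and free, and it removes exactly two ideals: the top
  \<open>P\<close> and \<open>P - {m'}\<close>, which covers the coatom \<open>P - {m, m'}\<close> of the smaller lattice. A snake grows by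
  a letter in the same way: a new top, and a new element above one of the two coatoms.

  From (3) to (1) (\<open>ex_khovanskii_basis\<close>). A snake has width two. Weight an ideal \<open>\<alpha>\<close> by
  \<open>\<bar>P\<bar>\<^sup>2 - \<bar>\<alpha>\<bar>\<^sup>2\<close>; by convexity \<open>x\<^sub>\<alpha> x\<^sub>\<beta>\<close> outweighs \<open>x\<^sub>\<alpha>\<^sub>\<inter>\<^sub>\<beta> x\<^sub>\<alpha>\<^sub>\<union>\<^sub>\<beta>\<close>, so any monomial order that refines
  the weight is compatible. Two products of binomials with the same leading monomial are two perfect
  matchings of the same multiset of vertices in the incomparability graph of \<open>L\<close>. In width two
  they are connected by exchanges along four-cycles, every four-cycle is a ladder, and in a
  ladder a three-term Pluecker relation expresses the effect of an exchange by a product of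
  binomials of smaller weight (\<open>exchange_relation\<close>). Hence one product for each monomial spans the
  algebra. These products have different leading monomials, so every leading monomial of the
  algebra is the leading monomial of one of them.

  From (1) to (2) (\<open>khovanskii_imp_free\<close>). Subposets \<open>(2+2)\<close> and \<open>(1+1+1)\<close> give sublattices of \<open>L\<close>
  that are a \<open>3 \<times> 3\<close> grid and a cube. In each of them two products of binomials with the same leading
  monomial have a nonzero difference all of whose monomials contain the least or the greatest
  element of the sublattice. Such a monomial is not a product of incomparable pairs.
\<close>

section \<open>Leading monomials and initial algebras\<close>

interpretation mpoly: vector_space "mscale :: 'k::field \<Rightarrow> ('v, 'k) mpoly \<Rightarrow> ('v, 'k) mpoly"
  by (rule vector_space_mscale)

definition var_monomial :: "'v \<Rightarrow> 'v \<Rightarrow>\<^sub>0 nat" where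
  "var_monomial v = Poly_Mapping.single v 1"

lemma keys_var_monomial [simp]: "Poly_Mapping.keys (var_monomial v) = {v}"
  by (simp add: var_monomial_def)

lemma lookup_var_monomial: "Poly_Mapping.lookup (var_monomial v) u = (if u = v then 1 else 0)"
  by (simp add: var_monomial_def lookup_single when_def)

lemma mvar_eq_single: "mvar v = Poly_Mapping.single (var_monomial v) 1"
  by (simp add: mvar_def var_monomial_def)

text \<open>
  All subalgebras of initial terms below are spanned by monomials, and are described as the
  polynomials supported on a set of monomials.
\<close>

definition supported_on :: "('v \<Rightarrow>\<^sub>0 nat) set \<Rightarrow> ('v, 'k::field) mpoly set" where
  "supported_on M = {p. Poly_Mapping.keys p \<subseteq> M}"

lemma supported_onD: "p \<in> supported_on M \<Longrightarrow> m \<in> Poly_Mapping.keys p \<Longrightarrow> m \<in> M"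
  by (auto simp: supported_on_def)

lemma supported_on_mono: "M \<subseteq> N \<Longrightarrow> p \<in> supported_on M \<Longrightarrow> p \<in> supported_on N"
  by (auto simp: supported_on_def)

lemma supported_on_inject:
  "supported_on M = (supported_on N :: ('v, 'k::field) mpoly set) \<longleftrightarrow> M = N"
proof -
  have "m \<in> M \<longleftrightarrow> Poly_Mapping.single m 1 \<in> (supported_on M :: ('v, 'k) mpoly set)" for m M
    by (simp add: supported_on_def)
  then show ?thesis by blast
qed

lemma supported_on_0 [simp]: "0 \<in> supported_on M"
  by (simp add: supported_on_def)

lemma supported_on_add: "p \<in> supported_on M \<Longrightarrow> q \<in> supported_on M \<Longrightarrow> p + q \<in> supported_on M"
  using keys_add[of p q] by (auto simp: supported_on_def)

lemma supported_on_diff: "p \<in> supported_on M \<Longrightarrow> q \<in> supported_on M \<Longrightarrow> p - q \<in> supported_on M"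
  using keys_diff[of p q] by (auto simp: supported_on_def)

lemma supported_on_uminus: "p \<in> supported_on M \<Longrightarrow> - p \<in> supported_on M"
  by (auto simp: supported_on_def)

lemma supported_on_mult:
  assumes "p \<in> supported_on M" "q \<in> supported_on N"
    and "\<And>a b. a \<in> M \<Longrightarrow> b \<in> N \<Longrightarrow> a + b \<in> K"
  shows "p * q \<in> supported_on K"
  using keys_mult[of p q] assms unfolding supported_on_def by blast

lemma supported_on_single: "m \<in> M \<Longrightarrow> Poly_Mapping.single m c \<in> supported_on M"
  by (simp add: supported_on_def)

lemma mpoly_sum_terms:
  "(p :: ('v, 'k::field) mpoly) =
     (\<Sum>m\<in>Poly_Mapping.keys p. Poly_Mapping.single m (Poly_Mapping.lookup p m))"
proof (rule poly_mapping_eqI)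
  fix m
  have "(\<Sum>i\<in>Poly_Mapping.keys p. Poly_Mapping.lookup p i when i = m) = Poly_Mapping.lookup p m"
  proof (cases "m \<in> Poly_Mapping.keys p")
    case True
    then show ?thesis
      by (simp add: when_def sum.delta)
  next
    case False
    then show ?thesis
      by (auto simp: when_def in_keys_iff intro!: sum.neutral)
  qed
  then show "Poly_Mapping.lookup p m =
      Poly_Mapping.lookup (\<Sum>m\<in>Poly_Mapping.keys p. Poly_Mapping.single m (Poly_Mapping.lookup p m)) m"
    by (simp add: lookup_sum lookup_single)
qed

lemma mscale_single: "mscale c (Poly_Mapping.single m d) = Poly_Mapping.single m (c * d)"
  by (simp add: mscale_def mult_single)

lemma subspace_supported_on:
  "mpoly.subspace (supported_on M :: ('v, 'k::field) mpoly set)"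
proof (rule mpoly.subspaceI)
  fix c :: 'k and p :: "('v, 'k) mpoly"
  assume p: "p \<in> supported_on M"
  show "mscale c p \<in> supported_on M"
    unfolding mscale_def
    by (rule supported_on_mult[OF supported_on_single[of 0 "{0}"] p]) auto
qed (auto intro: supported_on_add)

lemma is_subalgebra_supported_on:
  assumes "0 \<in> M" "\<And>a b. a \<in> M \<Longrightarrow> b \<in> M \<Longrightarrow> a + b \<in> M"
  shows "is_subalgebra (supported_on M)"
  unfolding is_subalgebra_def
  by (intro conjI allI ballI supported_on_single supported_on_add)
     (use assms supported_on_mult[of _ M _ M M] in blast)+

lemma is_subalgebra_generated: "is_subalgebra (subalgebra_generated F)"
  unfolding subalgebra_generated_def by (rule hull_in) (auto simp: is_subalgebra_def)

lemma subalgebra_generated_base: "f \<in> F \<Longrightarrow> f \<in> subalgebra_generated F"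
  unfolding subalgebra_generated_def by (rule hull_inc)

lemma subalgebra_generated_minimal:
  "F \<subseteq> R \<Longrightarrow> is_subalgebra R \<Longrightarrow> subalgebra_generated F \<subseteq> R"
  unfolding subalgebra_generated_def by (rule hull_minimal)

lemma is_subalgebra_const: "is_subalgebra R \<Longrightarrow> Poly_Mapping.single 0 c \<in> R"
  by (simp add: is_subalgebra_def)

lemma is_subalgebra_add: "is_subalgebra R \<Longrightarrow> p \<in> R \<Longrightarrow> q \<in> R \<Longrightarrow> p + q \<in> R"
  by (simp add: is_subalgebra_def)

lemma is_subalgebra_mult: "is_subalgebra R \<Longrightarrow> p \<in> R \<Longrightarrow> q \<in> R \<Longrightarrow> p * q \<in> R"
  by (simp add: is_subalgebra_def)

lemma is_subalgebra_one: "is_subalgebra R \<Longrightarrow> 1 \<in> R"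
  using is_subalgebra_const[of R 1] by simp

lemma is_subalgebra_diff:
  assumes "is_subalgebra R" "p \<in> R" "q \<in> R"
  shows "p - q \<in> R"
proof -
  have "Poly_Mapping.single 0 (- 1) * q = - q"
    by (simp add: single_uminus)
  then have "- q \<in> R"
    using is_subalgebra_mult[OF assms(1) is_subalgebra_const[OF assms(1), of "- 1"] assms(3)] by simp
  then show ?thesis
    using is_subalgebra_add[OF assms(1,2), of "- q"] by simp
qed

lemma is_subalgebra_sum:
  "is_subalgebra R \<Longrightarrow> (\<And>i. i \<in> I \<Longrightarrow> f i \<in> R) \<Longrightarrow> sum f I \<in> R"
proof (induction I rule: infinite_finite_induct)
  case (infinite I)
  then show ?case using is_subalgebra_const[of R 0] by simp
next
  case empty
  then show ?case using is_subalgebra_const[of R 0] by simp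
next
  case (insert i I)
  then show ?case by (simp add: is_subalgebra_add)
qed

lemma leading_monomial_eqI:
  assumes "antisym ord" "m \<in> Poly_Mapping.keys p" "\<And>m'. m' \<in> Poly_Mapping.keys p \<Longrightarrow> (m', m) \<in> ord"
  shows "leading_monomial ord p = m"
  unfolding leading_monomial_def
  by (rule the_equality) (use assms in \<open>auto dest: antisymD\<close>)

lemma linear_order_on_finite_has_greatest:
  assumes "linear_order_on X ord" "finite S" "S \<noteq> {}" "S \<subseteq> X"
  shows "\<exists>m\<in>S. \<forall>x\<in>S. (x, m) \<in> ord"
  using assms(2-4)
proof (induction S rule: finite_ne_induct)
  case (singleton x)
  then show ?case using assms(1) by (simp add: order_on_defs refl_on_def)
next
  case (insert x S)
  then obtain m where m: "m \<in> S" "\<forall>y\<in>S. (y, m) \<in> ord" by blast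
  have x: "x \<in> X" and mX: "m \<in> X"
    using insert.prems m(1) by auto
  have refl: "(x, x) \<in> ord" "trans ord"
    using assms(1) x by (simp_all add: order_on_defs refl_on_def)
  have "(x, m) \<in> ord \<or> (m, x) \<in> ord"
    using assms(1) x mX refl(1) by (cases "x = m") (simp_all add: order_on_defs total_on_def)
  then show ?case
  proof
    assume "(x, m) \<in> ord"
    with m show ?case by blast
  next
    assume "(m, x) \<in> ord"
    then have "(y, x) \<in> ord" if "y \<in> S" for y
      using transD[OF refl(2), of y m x] m(2) that by blast
    then show ?case using refl(1) by blast
  qed
qed

lemma leading_monomial_greatest:
  assumes "linear_order_on X ord" "p \<in> supported_on X" "p \<noteq> 0"
  shows "leading_monomial ord p \<in> Poly_Mapping.keys p"
    and "m \<in> Poly_Mapping.keys p \<Longrightarrow> (m, leading_monomial ord p) \<in> ord"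
proof -
  obtain m0 where m0: "m0 \<in> Poly_Mapping.keys p" "\<forall>x\<in>Poly_Mapping.keys p. (x, m0) \<in> ord"
    using linear_order_on_finite_has_greatest[OF assms(1) finite_keys, of p] assms(2,3)
    by (auto simp only: supported_on_def keys_eq_empty mem_Collect_eq)
  have "antisym ord"
    using assms(1) by (simp add: order_on_defs)
  then have lead: "leading_monomial ord p = m0"
    by (rule leading_monomial_eqI) (rule m0(1), rule bspec[OF m0(2)])
  show "leading_monomial ord p \<in> Poly_Mapping.keys p"
    unfolding lead by (rule m0(1))
  show "(m, leading_monomial ord p) \<in> ord" if "m \<in> Poly_Mapping.keys p"
    unfolding lead by (rule bspec[OF m0(2) that])
qed

text \<open>
  Over a field an initial algebra is determined by its monomials: coefficients can be scaled away.
\<close>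

lemma initial_algebra_eq_supported_on:
  fixes R :: "('v, 'k::field) mpoly set"
  assumes "linear_order_on X ord" "R \<subseteq> supported_on X"
  shows "initial_algebra ord R = supported_on (leading_monomial ord ` (R - {0}))" (is "_ = supported_on ?M")
proof
  show "initial_algebra ord R \<subseteq> supported_on ?M"
    unfolding initial_algebra_def
    by (rule mpoly.span_minimal[OF _ subspace_supported_on])
       (auto simp: initial_term_def intro!: supported_on_single)
next
  let ?T = "{initial_term ord f |f. f \<in> R \<and> f \<noteq> 0}"
  have term_in: "Poly_Mapping.single m c \<in> mpoly.span ?T" if m: "m \<in> ?M" for m and c :: 'k
  proof -
    from m obtain f where f: "f \<in> R" "f \<noteq> 0" "m = leading_monomial ord f" by auto
    define d where "d = Poly_Mapping.lookup f m"
    have "d \<noteq> 0"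
      using leading_monomial_greatest(1)[OF assms(1) _ f(2)] assms(2) f
      by (auto simp: d_def in_keys_iff)
    then have "Poly_Mapping.single m c = mscale (c / d) (initial_term ord f)"
      by (simp add: initial_term_def mscale_single f(3) d_def)
    moreover have "initial_term ord f \<in> ?T"
      using f by blast
    ultimately show ?thesis
      by (simp add: mpoly.span_scale mpoly.span_base)
  qed
  show "supported_on ?M \<subseteq> initial_algebra ord R"
  proof
    fix p :: "('v, 'k) mpoly"
    assume p: "p \<in> supported_on ?M"
    show "p \<in> initial_algebra ord R"
      unfolding initial_algebra_def
      by (subst mpoly_sum_terms[of p], rule mpoly.span_sum, rule term_in, rule supported_onD[OF p])
  qed
qed


section \<open>Products of incomparable pairs\<close>

inductive_set incomparable_monomials :: "'a set set \<Rightarrow> ('a set \<Rightarrow>\<^sub>0 nat) set" for L where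
  zero: "0 \<in> incomparable_monomials L"
| add: "\<lbrakk>\<alpha> \<in> L; \<beta> \<in> L; incomparable \<alpha> \<beta>; m \<in> incomparable_monomials L\<rbrakk> \<Longrightarrow>
    var_monomial \<alpha> + var_monomial \<beta> + m \<in> incomparable_monomials L"

lemma incomparable_sym: "incomparable \<alpha> \<beta> \<Longrightarrow> incomparable \<beta> \<alpha>"
  by (simp add: incomparable_def)

lemma incomparable_monomials_add:
  "m \<in> incomparable_monomials L \<Longrightarrow> m' \<in> incomparable_monomials L \<Longrightarrow>
    m + m' \<in> incomparable_monomials L"
  by (induction rule: incomparable_monomials.induct)
     (auto simp: add.assoc intro: incomparable_monomials.add[unfolded add.assoc])

lemma keys_add_nat: "Poly_Mapping.keys (a + b) = Poly_Mapping.keys a \<union> Poly_Mapping.keys (b :: 'v \<Rightarrow>\<^sub>0 nat)"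
  by (auto simp: in_keys_iff lookup_add)

lemma incomparable_monomials_partner:
  "m \<in> incomparable_monomials L \<Longrightarrow> \<alpha> \<in> Poly_Mapping.keys m \<Longrightarrow>
    \<exists>\<beta>\<in>Poly_Mapping.keys m. incomparable \<alpha> \<beta>"
  by (induction rule: incomparable_monomials.induct) (auto simp: keys_add_nat incomparable_sym)

lemma mvar_mult_mvar:
  "mvar \<alpha> * mvar \<beta> = Poly_Mapping.single (var_monomial \<alpha> + var_monomial \<beta>) 1"
  by (simp add: mvar_eq_single mult_single)

lemma subalgebra_generated_incomparable_pairs:
  "subalgebra_generated {mvar \<alpha> * mvar \<beta> | \<alpha> \<beta>. \<alpha> \<in> L \<and> \<beta> \<in> L \<and> incomparable \<alpha> \<beta>}
     = (supported_on (incomparable_monomials L) :: ('a set, 'k::field) mpoly set)"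
    (is "subalgebra_generated ?G = _")
proof
  have "var_monomial \<alpha> + var_monomial \<beta> \<in> incomparable_monomials L"
    if "\<alpha> \<in> L" "\<beta> \<in> L" "incomparable \<alpha> \<beta>" for \<alpha> \<beta>
    using incomparable_monomials.add[OF that incomparable_monomials.zero] by simp
  then show "subalgebra_generated ?G \<subseteq> (supported_on (incomparable_monomials L) :: ('a set, 'k) mpoly set)"
    by (intro subalgebra_generated_minimal is_subalgebra_supported_on)
       (auto simp: mvar_mult_mvar intro: incomparable_monomials.zero incomparable_monomials_add
         intro!: supported_on_single)
next
  let ?R = "subalgebra_generated ?G :: ('a set, 'k) mpoly set"
  have R: "is_subalgebra ?R" by (rule is_subalgebra_generated)
  have mon: "Poly_Mapping.single m 1 \<in> ?R" if "m \<in> incomparable_monomials L" for m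
    using that
  proof (induction rule: incomparable_monomials.induct)
    case zero
    show ?case by (rule is_subalgebra_const[OF R])
  next
    case (add \<alpha> \<beta> m)
    have "Poly_Mapping.single (var_monomial \<alpha> + var_monomial \<beta> + m) (1::'k)
        = (mvar \<alpha> * mvar \<beta>) * Poly_Mapping.single m 1"
      by (simp add: mvar_mult_mvar mult_single)
    moreover have "mvar \<alpha> * mvar \<beta> \<in> ?R"
      using add by (intro subalgebra_generated_base) auto
    ultimately show ?case
      using add.IH is_subalgebra_mult[OF R] by auto
  qed
  have term_in: "Poly_Mapping.single m c \<in> ?R" if "m \<in> incomparable_monomials L" for m and c :: 'k
  proof -
    have "Poly_Mapping.single m c = Poly_Mapping.single 0 c * Poly_Mapping.single m 1"
      by (simp add: mult_single)
    then show ?thesis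
      using is_subalgebra_mult[OF R is_subalgebra_const[OF R] mon[OF that]] by simp
  qed
  show "supported_on (incomparable_monomials L) \<subseteq> ?R"
  proof
    fix p :: "('a set, 'k) mpoly"
    assume p: "p \<in> supported_on (incomparable_monomials L)"
    show "p \<in> ?R"
      by (subst mpoly_sum_terms[of p], rule is_subalgebra_sum[OF R], rule term_in, rule supported_onD[OF p])
  qed
qed

lemma lattice_algebra_supported_on:
  assumes "\<And>\<alpha> \<beta>. \<alpha> \<in> L \<Longrightarrow> \<beta> \<in> L \<Longrightarrow> \<alpha> \<inter> \<beta> \<in> L" "\<And>\<alpha> \<beta>. \<alpha> \<in> L \<Longrightarrow> \<beta> \<in> L \<Longrightarrow> \<alpha> \<union> \<beta> \<in> L"
  shows "(lattice_algebra L :: ('a set, 'k::field) mpoly set) \<subseteq> supported_on (monomials_in L)"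
  unfolding lattice_algebra_def
proof (rule subalgebra_generated_minimal)
  show "is_subalgebra (supported_on (monomials_in L) :: ('a set, 'k) mpoly set)"
    by (rule is_subalgebra_supported_on) (auto simp: monomials_in_def keys_add_nat)
  show "(lattice_binomials L :: ('a set, 'k) mpoly set) \<subseteq> supported_on (monomials_in L)"
    using assms
    by (auto simp: lattice_binomials_def lattice_binomial_def mvar_mult_mvar monomials_in_def keys_add_nat
        intro!: supported_on_diff supported_on_single)
qed

text \<open>
  For a compatible order the initial terms of the binomials are the products of incomparable
  pairs, so the Khovanskii property becomes a statement about monomials alone.
\<close>

lemma khovanskii_basis_iff_leading_monomials:
  assumes "\<And>\<alpha> \<beta>. \<alpha> \<in> L \<Longrightarrow> \<beta> \<in> L \<Longrightarrow> \<alpha> \<inter> \<beta> \<in> L" "\<And>\<alpha> \<beta>. \<alpha> \<in> L \<Longrightarrow> \<beta> \<in> L \<Longrightarrow> \<alpha> \<union> \<beta> \<in> L"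
    and "compatible_order TYPE('k::field) L ord"
  shows "khovanskii_basis ord (lattice_algebra L :: ('a set, 'k) mpoly set) (lattice_binomials L) \<longleftrightarrow>
    leading_monomial ord ` ((lattice_algebra L :: ('a set, 'k) mpoly set) - {0}) = incomparable_monomials L"
    (is "_ \<longleftrightarrow> ?M = _")
proof -
  have lin: "linear_order_on (monomials_in L) ord"
    using assms(3) by (auto simp: compatible_order_def monomial_order_def)
  have "{initial_term ord f |f. f \<in> (lattice_binomials L :: ('a set, 'k) mpoly set)}
      = {mvar \<alpha> * mvar \<beta> | \<alpha> \<beta>. \<alpha> \<in> L \<and> \<beta> \<in> L \<and> incomparable \<alpha> \<beta>}"
    using assms(3) unfolding compatible_order_def lattice_binomials_def by force
  then have "subalgebra_generated {initial_term ord f |f. f \<in> (lattice_binomials L :: ('a set, 'k) mpoly set)}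
      = supported_on (incomparable_monomials L)"
    by (simp only: subalgebra_generated_incomparable_pairs)
  moreover have "initial_algebra ord (lattice_algebra L :: ('a set, 'k) mpoly set) = supported_on ?M"
    by (rule initial_algebra_eq_supported_on[OF lin lattice_algebra_supported_on]) (fact assms)+
  moreover have "(lattice_binomials L :: ('a set, 'k) mpoly set) \<subseteq> lattice_algebra L"
    unfolding lattice_algebra_def by (blast intro: subalgebra_generated_base)
  ultimately have "khovanskii_basis ord (lattice_algebra L :: ('a set, 'k) mpoly set) (lattice_binomials L) \<longleftrightarrow>
      supported_on (incomparable_monomials L) = (supported_on ?M :: ('a set, 'k) mpoly set)"
    by (simp only: khovanskii_basis_def simp_thms)
  then show ?thesis
    unfolding supported_on_inject by (simp only: eq_commute)
qed


section \<open>Lattices that contain a grid or a cube\<close>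

text \<open>
  In a product of incomparable pairs every variable has a partner incomparable to it. Hence the
  leading monomial of a nonzero element of the algebra is not such a product if each of its
  monomials contains a variable comparable to all of its variables.
\<close>

definition central_monomials :: "('a set \<Rightarrow>\<^sub>0 nat) set" where
  "central_monomials =
     {m. \<exists>\<zeta>\<in>Poly_Mapping.keys m. \<forall>\<alpha>\<in>Poly_Mapping.keys m. \<not> incomparable \<zeta> \<alpha>}"

lemma supported_on_central_monomials:
  assumes "h \<in> supported_on (monomials_in S)" "\<zeta> \<in> S" "\<And>\<alpha>. \<alpha> \<in> S \<Longrightarrow> \<not> incomparable \<zeta> \<alpha>"
  shows "mvar \<zeta> * h \<in> supported_on central_monomials"
  unfolding mvar_eq_single
  by (rule supported_on_mult[OF supported_on_single[of _ "{var_monomial \<zeta>}"] assms(1)])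
     (use assms in \<open>auto simp: central_monomials_def monomials_in_def keys_add_nat\<close>)

lemma no_central_khovanskii:
  fixes g :: "('a set, 'k::field) mpoly"
  assumes L: "\<And>\<alpha> \<beta>. \<alpha> \<in> L \<Longrightarrow> \<beta> \<in> L \<Longrightarrow> \<alpha> \<inter> \<beta> \<in> L" "\<And>\<alpha> \<beta>. \<alpha> \<in> L \<Longrightarrow> \<beta> \<in> L \<Longrightarrow> \<alpha> \<union> \<beta> \<in> L"
    and comp: "compatible_order TYPE('k) L ord"
    and khov: "khovanskii_basis ord (lattice_algebra L :: ('a set, 'k) mpoly set) (lattice_binomials L)"
    and g: "g \<in> lattice_algebra L" "g \<in> supported_on central_monomials"
  shows "g = 0"
proof (rule ccontr)
  assume "g \<noteq> 0"
  have "linear_order_on (monomials_in L) ord"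
    using comp by (simp add: compatible_order_def monomial_order_def)
  moreover have "g \<in> supported_on (monomials_in L)"
    using lattice_algebra_supported_on[OF L] g(1) by blast
  ultimately have "leading_monomial ord g \<in> central_monomials"
    using leading_monomial_greatest(1) \<open>g \<noteq> 0\<close> g(2) supported_onD by metis
  moreover have "leading_monomial ord g \<in> incomparable_monomials L"
    using khov g(1) \<open>g \<noteq> 0\<close> khovanskii_basis_iff_leading_monomials[OF L comp] by blast
  ultimately show False
    using incomparable_monomials_partner unfolding central_monomials_def by blast
qed

lemma supported_on_monomials_in_mult:
  "p \<in> supported_on (monomials_in S) \<Longrightarrow> q \<in> supported_on (monomials_in S) \<Longrightarrow>
    p * q \<in> supported_on (monomials_in S)"
  by (rule supported_on_mult) (auto simp: monomials_in_def keys_add_nat)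

lemma mvar_supported_on: "\<alpha> \<in> S \<Longrightarrow> mvar \<alpha> \<in> supported_on (monomials_in S)"
  by (auto simp: mvar_eq_single monomials_in_def intro: supported_on_single)

lemma lattice_binomial_in_algebra:
  "\<alpha> \<in> L \<Longrightarrow> \<beta> \<in> L \<Longrightarrow> incomparable \<alpha> \<beta> \<Longrightarrow> lattice_binomial \<alpha> \<beta> \<in> lattice_algebra L"
  unfolding lattice_algebra_def lattice_binomials_def by (rule subalgebra_generated_base) blast

lemma binomial_exchange_in_algebra:
  assumes "\<alpha> \<in> L" "\<beta> \<in> L" "\<gamma> \<in> L" "\<delta> \<in> L"
    and "incomparable \<alpha> \<beta>" "incomparable \<gamma> \<delta>" "incomparable \<alpha> \<delta>" "incomparable \<gamma> \<beta>"
  shows "lattice_binomial \<alpha> \<beta> * lattice_binomial \<gamma> \<delta> - lattice_binomial \<alpha> \<delta> * lattice_binomial \<gamma> \<beta>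
    \<in> lattice_algebra L"
  using assms unfolding lattice_algebra_def
  by (intro is_subalgebra_diff is_subalgebra_mult is_subalgebra_generated
      lattice_binomial_in_algebra[unfolded lattice_algebra_def])

lemma lookup_single_other:
  "Poly_Mapping.lookup m v \<noteq> Poly_Mapping.lookup m' v \<Longrightarrow>
    Poly_Mapping.lookup (Poly_Mapping.single m c) m' = 0"
  by (auto simp: lookup_single when_def)

text \<open>
  With \<open>z = a\<^sub>2 \<inter> b\<^sub>2\<close> as \<open>a\<^sub>0\<close> and \<open>b\<^sub>0\<close>, the sets \<open>a\<^sub>i \<union> b\<^sub>j\<close> form a grid with three rows and
  columns. Up to sign the element \<open>h\<close> of the proof is the determinant of the corresponding
  matrix of variables. Thus a difference of two products of minors of size two is the entry
  \<open>x\<^sub>z\<close> times the determinant, and \<open>z\<close> lies below all sets of the grid.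
\<close>

lemma no_khovanskii_grid:
  fixes L :: "'a set set"
  assumes L: "\<And>\<alpha> \<beta>. \<alpha> \<in> L \<Longrightarrow> \<beta> \<in> L \<Longrightarrow> \<alpha> \<inter> \<beta> \<in> L" "\<And>\<alpha> \<beta>. \<alpha> \<in> L \<Longrightarrow> \<beta> \<in> L \<Longrightarrow> \<alpha> \<union> \<beta> \<in> L"
    and comp: "compatible_order TYPE('k::field) L ord"
    and khov: "khovanskii_basis ord (lattice_algebra L :: ('a set, 'k) mpoly set) (lattice_binomials L)"
    and in_L: "a1 \<in> L" "a2 \<in> L" "b1 \<in> L" "b2 \<in> L"
    and grid: "a1 \<subset> a2" "b1 \<subset> b2" "a2 \<inter> b2 \<subset> a1" "a2 \<inter> b2 \<subset> b1"
  shows False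
proof -
  define z where "z = a2 \<inter> b2"
  have meets: "b2 \<inter> a1 = z" "b1 \<inter> a2 = z" "b2 \<inter> a2 = z" "b1 \<inter> a1 = z"
    using grid by (auto simp: z_def)
  have incomp: "incomparable b2 a1" "incomparable b1 a2" "incomparable b2 a2" "incomparable b1 a1"
    using grid by (auto simp: incomparable_def)
  define S where "S = {\<alpha>. z \<subseteq> \<alpha>}"
  have in_S: "z \<in> S" "a1 \<in> S" "a2 \<in> S" "b1 \<in> S" "b2 \<in> S"
      "b2 \<union> a1 \<in> S" "b1 \<union> a2 \<in> S" "b2 \<union> a2 \<in> S" "b1 \<union> a1 \<in> S"
    using grid by (auto simp: S_def z_def)
  define g :: "('a set, 'k) mpoly" where
    "g = lattice_binomial b2 a1 * lattice_binomial b1 a2 - lattice_binomial b2 a2 * lattice_binomial b1 a1"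
  define h :: "('a set, 'k) mpoly" where
    "h = mvar b2 * mvar a2 * mvar (b1 \<union> a1) + mvar (b2 \<union> a2) * mvar b1 * mvar a1
       - mvar b2 * mvar a1 * mvar (b1 \<union> a2) - mvar (b2 \<union> a1) * mvar b1 * mvar a2
       + mvar z * mvar (b2 \<union> a1) * mvar (b1 \<union> a2) - mvar z * mvar (b2 \<union> a2) * mvar (b1 \<union> a1)"
  have g_eq: "g = mvar z * h"
    by (simp add: g_def h_def lattice_binomial_def meets algebra_simps)
  have "h \<in> supported_on (monomials_in S)"
    unfolding h_def
    by (intro supported_on_add supported_on_diff supported_on_monomials_in_mult mvar_supported_on in_S)
  then have "g \<in> supported_on central_monomials"
    unfolding g_eq
    by (rule supported_on_central_monomials) (auto simp: S_def incomparable_def)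
  moreover have "g \<in> lattice_algebra L"
    unfolding g_def by (rule binomial_exchange_in_algebra) (fact in_L incomp)+
  moreover have "g \<noteq> 0"
  proof -
    have neq: "z \<noteq> a2" "a1 \<noteq> a2" "b1 \<noteq> a2" "b2 \<noteq> a2" "b1 \<union> a1 \<noteq> a2" "b1 \<union> a2 \<noteq> a2" "b2 \<union> a1 \<noteq> a2" "b2 \<union> a2 \<noteq> a2"
        "z \<noteq> b2" "a1 \<noteq> b2" "b1 \<noteq> b2" "b2 \<union> a1 \<noteq> b2" "b1 \<union> a2 \<noteq> b2" "b2 \<union> a2 \<noteq> b2" "b1 \<union> a1 \<noteq> b2"
      using grid unfolding z_def by blast+
    let ?v = "var_monomial"
    \<comment> \<open>The only monomial of the difference in which \<open>a2\<close> and \<open>b2\<close> both occur.\<close>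
    define m where "m = ?v z + ?v b2 + ?v a2 + ?v (b1 \<union> a1)"
    have at: "Poly_Mapping.lookup m a2 = 1" "Poly_Mapping.lookup m b2 = 1"
      using neq by (simp_all add: m_def lookup_add lookup_var_monomial)
    have g_terms: "g = Poly_Mapping.single m 1
        + Poly_Mapping.single (?v z + ?v (b2 \<union> a2) + ?v b1 + ?v a1) 1
        - Poly_Mapping.single (?v z + ?v b2 + ?v a1 + ?v (b1 \<union> a2)) 1
        - Poly_Mapping.single (?v z + ?v (b2 \<union> a1) + ?v b1 + ?v a2) 1
        + Poly_Mapping.single (?v z + ?v z + ?v (b2 \<union> a1) + ?v (b1 \<union> a2)) 1
        - Poly_Mapping.single (?v z + ?v z + ?v (b2 \<union> a2) + ?v (b1 \<union> a1)) 1"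
      by (simp add: g_eq h_def m_def mvar_eq_single mult_single distrib_left right_diff_distrib ac_simps)
    have "Poly_Mapping.lookup (Poly_Mapping.single (?v z + ?v (b2 \<union> a2) + ?v b1 + ?v a1) (1::'k)) m = 0"
      "Poly_Mapping.lookup (Poly_Mapping.single (?v z + ?v b2 + ?v a1 + ?v (b1 \<union> a2)) (1::'k)) m = 0"
      "Poly_Mapping.lookup (Poly_Mapping.single (?v z + ?v z + ?v (b2 \<union> a1) + ?v (b1 \<union> a2)) (1::'k)) m = 0"
      "Poly_Mapping.lookup (Poly_Mapping.single (?v z + ?v z + ?v (b2 \<union> a2) + ?v (b1 \<union> a1)) (1::'k)) m = 0"
      by (rule lookup_single_other[of _ a2], use neq at in \<open>simp add: lookup_add lookup_var_monomial\<close>)+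
    moreover have "Poly_Mapping.lookup (Poly_Mapping.single (?v z + ?v (b2 \<union> a1) + ?v b1 + ?v a2) (1::'k)) m = 0"
      by (rule lookup_single_other[of _ b2], use neq at in \<open>simp add: lookup_add lookup_var_monomial\<close>)
    ultimately have "Poly_Mapping.lookup g m = 1"
      unfolding g_terms lookup_add lookup_minus by simp
    then show ?thesis by auto
  qed
  ultimately show False
    using no_central_khovanskii[OF L comp khov] by blast
qed

text \<open>
  Here \<open>z\<close> and \<open>t\<close> are the bottom and the top of a cube with atoms \<open>x\<^sub>i\<close> and coatoms \<open>y\<^sub>i\<close>, where
  \<open>y\<^sub>i\<close> is the complement of \<open>x\<^sub>i\<close>. The monomial \<open>x\<^sub>1 x\<^sub>2 y\<^sub>1 y\<^sub>2\<close> is a product of incomparable pairs in two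
  ways; in the difference of the corresponding products of binomials it cancels, and each of the
  remaining monomials contains \<open>z\<close> or \<open>t\<close>.
\<close>

lemma no_khovanskii_cube:
  fixes L :: "'a set set"
  assumes L: "\<And>\<alpha> \<beta>. \<alpha> \<in> L \<Longrightarrow> \<beta> \<in> L \<Longrightarrow> \<alpha> \<inter> \<beta> \<in> L" "\<And>\<alpha> \<beta>. \<alpha> \<in> L \<Longrightarrow> \<beta> \<in> L \<Longrightarrow> \<alpha> \<union> \<beta> \<in> L"
    and comp: "compatible_order TYPE('k::field) L ord"
    and khov: "khovanskii_basis ord (lattice_algebra L :: ('a set, 'k) mpoly set) (lattice_binomials L)"
    and in_L: "x1 \<in> L" "x2 \<in> L" "x3 \<in> L"
    and cube: "z \<subset> x1" "z \<subset> x2" "z \<subset> x3" "x1 \<inter> x2 = z" "x1 \<inter> x3 = z" "x2 \<inter> x3 = z"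
  shows False
proof -
  define t y1 y2 y3 where "t = x1 \<union> x2 \<union> x3" and "y1 = x2 \<union> x3" and "y2 = x1 \<union> x3" and "y3 = x1 \<union> x2"
  note defs = t_def y1_def y2_def y3_def
  have y_in_L: "y1 \<in> L" "y2 \<in> L"
    using in_L L(2) by (simp_all add: defs)
  have meets: "x1 \<inter> x2 = z" "y2 \<inter> y1 = x3" "x1 \<inter> y1 = z" "y2 \<inter> x2 = z"
    and joins: "x1 \<union> x2 = y3" "y2 \<union> y1 = t" "x1 \<union> y1 = t" "y2 \<union> x2 = t"
    using cube by (auto simp: defs)
  have incomp: "incomparable x1 x2" "incomparable y2 y1" "incomparable x1 y1" "incomparable y2 x2"
    using cube unfolding incomparable_def defs by blast+
  define S where "S = {\<alpha>. z \<subseteq> \<alpha> \<and> \<alpha> \<subseteq> t}"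
  have in_S: "z \<in> S" "t \<in> S" "x1 \<in> S" "x2 \<in> S" "x3 \<in> S" "y1 \<in> S" "y2 \<in> S" "y3 \<in> S"
    using cube by (auto simp: S_def defs)
  define g :: "('a set, 'k) mpoly" where
    "g = lattice_binomial x1 x2 * lattice_binomial y2 y1 - lattice_binomial x1 y1 * lattice_binomial y2 x2"
  define h :: "('a set, 'k) mpoly" where
    "h = mvar t * mvar x1 * mvar y1 + mvar t * mvar x2 * mvar y2 + mvar t * mvar x3 * mvar y3
       - mvar y1 * mvar y2 * mvar y3 - mvar z * mvar t * mvar t"
  define h' :: "('a set, 'k) mpoly" where "h' = mvar x1 * mvar x2 * mvar x3"
  have g_eq: "g = mvar z * h - mvar t * h'"
    unfolding g_def h_def h'_def lattice_binomial_def meets joins by (simp add: algebra_simps)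
  have "h \<in> supported_on (monomials_in S)"
    unfolding h_def
    by (intro supported_on_add supported_on_diff supported_on_monomials_in_mult mvar_supported_on in_S)
  then have "mvar z * h \<in> supported_on central_monomials"
    by (rule supported_on_central_monomials) (use in_S in \<open>auto simp: S_def incomparable_def\<close>)
  moreover have "h' \<in> supported_on (monomials_in S)"
    unfolding h'_def by (intro supported_on_monomials_in_mult mvar_supported_on in_S)
  then have "mvar t * h' \<in> supported_on central_monomials"
    by (rule supported_on_central_monomials) (use in_S in \<open>auto simp: S_def incomparable_def\<close>)
  ultimately have "g \<in> supported_on central_monomials"
    unfolding g_eq by (rule supported_on_diff)
  moreover have "g \<in> lattice_algebra L"
    unfolding g_def by (rule binomial_exchange_in_algebra) (fact in_L y_in_L incomp)+
  moreover have "g \<noteq> 0"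
  proof -
    have neq: "t \<noteq> z" "x1 \<noteq> z" "x2 \<noteq> z" "x3 \<noteq> z" "y1 \<noteq> z" "y2 \<noteq> z" "y3 \<noteq> z"
      using cube unfolding defs by blast+
    let ?v = "var_monomial"
    \<comment> \<open>The only monomial of the difference in which \<open>z\<close> has exponent two.\<close>
    define m where "m = ?v z + ?v z + ?v t + ?v t"
    have at: "Poly_Mapping.lookup m z = 2"
      using neq by (simp add: m_def lookup_add lookup_var_monomial)
    have g_terms: "g = Poly_Mapping.single (?v z + ?v t + ?v x1 + ?v y1) 1
        + Poly_Mapping.single (?v z + ?v t + ?v x2 + ?v y2) 1
        + Poly_Mapping.single (?v z + ?v t + ?v x3 + ?v y3) 1
        - Poly_Mapping.single (?v z + ?v y1 + ?v y2 + ?v y3) 1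
        - Poly_Mapping.single m 1
        - Poly_Mapping.single (?v t + ?v x1 + ?v x2 + ?v x3) 1"
      by (simp add: g_eq h_def h'_def m_def mvar_eq_single mult_single distrib_left right_diff_distrib ac_simps)
    have "Poly_Mapping.lookup (Poly_Mapping.single (?v z + ?v t + ?v x1 + ?v y1) (1::'k)) m = 0"
      "Poly_Mapping.lookup (Poly_Mapping.single (?v z + ?v t + ?v x2 + ?v y2) (1::'k)) m = 0"
      "Poly_Mapping.lookup (Poly_Mapping.single (?v z + ?v t + ?v x3 + ?v y3) (1::'k)) m = 0"
      "Poly_Mapping.lookup (Poly_Mapping.single (?v z + ?v y1 + ?v y2 + ?v y3) (1::'k)) m = 0"
      "Poly_Mapping.lookup (Poly_Mapping.single (?v t + ?v x1 + ?v x2 + ?v x3) (1::'k)) m = 0"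
      by (rule lookup_single_other[of _ z], use neq at in \<open>simp add: lookup_add lookup_var_monomial\<close>)+
    then have "Poly_Mapping.lookup g m = - 1"
      unfolding g_terms lookup_add lookup_minus by simp
    then show ?thesis by auto
  qed
  ultimately show False
    using no_central_khovanskii[OF L comp khov] by blast
qed


section \<open>Monomial orders that refine a weight\<close>

definition monomial_weight :: "'v set \<Rightarrow> ('v \<Rightarrow> nat) \<Rightarrow> ('v \<Rightarrow>\<^sub>0 nat) \<Rightarrow> nat" where
  "monomial_weight V w m = (\<Sum>v\<in>V. Poly_Mapping.lookup m v * w v)"

lemma monomial_weight_0 [simp]: "monomial_weight V w 0 = 0"
  by (simp add: monomial_weight_def)

lemma monomial_weight_add [simp]:
  "monomial_weight V w (a + b) = monomial_weight V w a + monomial_weight V w b"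
  by (simp add: monomial_weight_def lookup_add distrib_right sum.distrib)

lemma monomial_weight_var [simp]:
  "finite V \<Longrightarrow> v \<in> V \<Longrightarrow> monomial_weight V w (var_monomial v) = w v"
  by (simp add: monomial_weight_def lookup_var_monomial if_distrib[of "\<lambda>x. x * _"] cong: if_cong)

lemma monomials_in_0 [simp]: "0 \<in> monomials_in V"
  by (simp add: monomials_in_def)

lemma monomials_in_add [simp]: "a + b \<in> monomials_in V \<longleftrightarrow> a \<in> monomials_in V \<and> b \<in> monomials_in V"
  by (simp add: monomials_in_def keys_add_nat)

lemma monomials_in_var [simp]: "var_monomial v \<in> monomials_in V \<longleftrightarrow> v \<in> V"
  by (simp add: monomials_in_def)

text \<open>
  Ties of the weight are broken lexicographically, with respect to an arbitrary enumeration of the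
  variables.
\<close>

lemma monomial_order_refining_weight:
  fixes V :: "'v set"
  assumes "finite V"
  shows "\<exists>ord. monomial_order V ord \<and>
    (\<forall>a\<in>monomials_in V. \<forall>b\<in>monomials_in V.
       monomial_weight V w a < monomial_weight V w b \<longrightarrow> (a, b) \<in> ord)"
proof -
  have "\<exists>e :: 'v \<Rightarrow> nat. inj_on e V"
    using finite_imp_inj_to_nat_seg[OF assms] by auto
  then obtain e :: "'v \<Rightarrow> nat" where e: "inj_on e V" ..
  let ?M = "monomials_in V"
  let ?wt = "monomial_weight V w"
  let ?l = Poly_Mapping.lookup
  define lex where "lex a b \<longleftrightarrow> (\<exists>x\<in>V. ?l a x < ?l b x \<and> (\<forall>y\<in>V. e y < e x \<longrightarrow> ?l a y = ?l b y))"
    for a b :: "'v \<Rightarrow>\<^sub>0 nat"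
  have lex_total: "lex a b \<or> lex b a" if "a \<in> ?M" "b \<in> ?M" "a \<noteq> b" for a b
  proof -
    obtain x where x: "?l a x \<noteq> ?l b x"
      using \<open>a \<noteq> b\<close> by (auto simp: poly_mapping_eq_iff fun_eq_iff)
    then have "x \<in> Poly_Mapping.keys a \<or> x \<in> Poly_Mapping.keys b"
      by (metis in_keys_iff)
    with that have "x \<in> V"
      by (auto simp: monomials_in_def)
    define x' where "x' = arg_min e (\<lambda>x. x \<in> V \<and> ?l a x \<noteq> ?l b x)"
    have x': "x' \<in> V" "?l a x' \<noteq> ?l b x'"
      using arg_min_natI[of "\<lambda>x. x \<in> V \<and> ?l a x \<noteq> ?l b x" x e] x \<open>x \<in> V\<close>
      by (simp_all add: x'_def)
    have least: "e x' \<le> e y" if "y \<in> V" "?l a y \<noteq> ?l b y" for y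
      unfolding x'_def by (rule arg_min_nat_le) (use that in simp)
    have eq: "\<forall>y\<in>V. e y < e x' \<longrightarrow> ?l a y = ?l b y"
      using least by (meson not_le)
    consider "?l a x' < ?l b x'" | "?l b x' < ?l a x'"
      using x'(2) by linarith
    then show ?thesis
      using eq x'(1) unfolding lex_def by cases (force intro: bexI[of _ x'])+
  qed
  have lex_trans: "lex a c" if "lex a b" "lex b c" for a b c
  proof -
    from that obtain x y where x: "x \<in> V" "?l a x < ?l b x" "\<forall>z\<in>V. e z < e x \<longrightarrow> ?l a z = ?l b z"
      and y: "y \<in> V" "?l b y < ?l c y" "\<forall>z\<in>V. e z < e y \<longrightarrow> ?l b z = ?l c z"
      unfolding lex_def by blast
    consider "e x < e y" | "e y < e x" | "x = y"
      using inj_onD[OF e _ x(1) y(1)] by linarith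
    then show ?thesis
    proof cases
      case 1
      then show ?thesis using x y unfolding lex_def by (intro bexI[of _ x]) auto
    next
      case 2
      then show ?thesis using x y unfolding lex_def by (intro bexI[of _ y]) auto
    next
      case 3
      then show ?thesis using x y unfolding lex_def by (intro bexI[of _ x]) auto
    qed
  qed
  have lex_irrefl: "\<not> lex a a" for a
    by (simp add: lex_def)
  have lex_add: "lex (a + c) (b + c)" if "lex a b" for a b c
    using that by (simp add: lex_def lookup_add)
  have lex_0: "lex 0 a" if "a \<in> ?M" "a \<noteq> 0" for a
    using lex_total[OF that(1) monomials_in_0 that(2)] by (auto simp: lex_def)
  define less where "less a b \<longleftrightarrow> ?wt a < ?wt b \<or> ?wt a = ?wt b \<and> lex a b" for a b
  define ord where "ord = {(a, b). a \<in> ?M \<and> b \<in> ?M \<and> (a = b \<or> less a b)}"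
  have less_trans: "less a c" if "less a b" "less b c" for a b c
    using that lex_trans[of a b c] by (auto simp: less_def)
  have less_irrefl: "\<not> less a a" for a
    by (simp add: less_def lex_irrefl)
  have "linear_order_on ?M ord"
    unfolding order_on_defs
  proof (intro conjI)
    show "ord \<subseteq> ?M \<times> ?M" "refl_on ?M ord"
      by (auto simp: ord_def refl_on_def)
    show "trans ord"
    proof (rule transI)
      fix a b c assume "(a, b) \<in> ord" "(b, c) \<in> ord"
      then show "(a, c) \<in> ord"
        using less_trans[of a b c] by (auto simp: ord_def)
    qed
    show "antisym ord"
    proof (rule antisymI)
      fix a b assume "(a, b) \<in> ord" "(b, a) \<in> ord"
      then show "a = b"
        using less_trans[of a b a] less_irrefl[of a] by (auto simp: ord_def)
    qed
    show "total_on ?M ord"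
      unfolding total_on_def
    proof (intro ballI impI)
      fix a b assume "a \<in> ?M" "b \<in> ?M" "a \<noteq> b"
      then show "(a, b) \<in> ord \<or> (b, a) \<in> ord"
        using lex_total[of a b] by (auto simp: ord_def less_def)
    qed
  qed
  moreover have "(0, m) \<in> ord" if "m \<in> ?M" for m
    using that lex_0[of m] by (auto simp: ord_def less_def)
  moreover have "(a + m, b + m) \<in> ord" if "m \<in> ?M" "(a, b) \<in> ord" for a b m
    using that lex_add[of a b m] by (auto simp: ord_def less_def)
  ultimately have "monomial_order V ord"
    by (simp add: monomial_order_def)
  moreover have "(a, b) \<in> ord" if "a \<in> ?M" "b \<in> ?M" "?wt a < ?wt b" for a b
    using that by (simp add: ord_def less_def)
  ultimately show ?thesis by blast
qed


section \<open>Products of lattice binomials\<close>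

text \<open>
  With a product of binomials the product of the heavier monomials of its factors is recorded, so
  that no monomial order has to be fixed.
\<close>

inductive binomial_product :: "'a set set \<Rightarrow> ('a set \<Rightarrow>\<^sub>0 nat) \<Rightarrow> ('a set, 'k::field) mpoly \<Rightarrow> bool" for L where
  one: "binomial_product L 0 1"
| mult: "\<lbrakk>\<alpha> \<in> L; \<beta> \<in> L; incomparable \<alpha> \<beta>; binomial_product L m p\<rbrakk> \<Longrightarrow>
    binomial_product L (var_monomial \<alpha> + var_monomial \<beta> + m) (lattice_binomial \<alpha> \<beta> * p)"

lemma lattice_binomial_commute: "lattice_binomial \<alpha> \<beta> = lattice_binomial \<beta> \<alpha>"
  by (simp add: lattice_binomial_def mult.commute Int_commute Un_commute)

lemma binomial_product_0: "binomial_product L m p \<Longrightarrow> Poly_Mapping.keys m = {} \<Longrightarrow> p = 1"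
  by (induction rule: binomial_product.induct) (simp_all only: keys_add_nat keys_var_monomial, auto)

text \<open>
  Any variable of the monomial can be brought to the front, together with its partner.
\<close>

lemma binomial_product_split:
  "binomial_product L m p \<Longrightarrow> \<alpha> \<in> Poly_Mapping.keys m \<Longrightarrow>
    \<exists>\<beta> m' p'. \<alpha> \<in> L \<and> \<beta> \<in> L \<and> incomparable \<alpha> \<beta> \<and> binomial_product L m' p' \<and>
      m = var_monomial \<alpha> + var_monomial \<beta> + m' \<and> p = lattice_binomial \<alpha> \<beta> * p'"
proof (induction rule: binomial_product.induct)
  case one
  then show ?case by simp
next
  case (mult \<gamma> \<delta> m p)
  show ?case
  proof (cases "\<alpha> \<in> {\<gamma>, \<delta>}")
    case True
    then consider "\<alpha> = \<gamma>" | "\<alpha> = \<delta>" by blast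
    then show ?thesis
    proof cases
      case 1
      with mult.hyps show ?thesis by blast
    next
      case 2
      show ?thesis
        unfolding 2 lattice_binomial_commute[of \<gamma> \<delta>] add.commute[of "var_monomial \<gamma>" "var_monomial \<delta>"]
        using mult.hyps incomparable_sym[of \<gamma> \<delta>] by blast
    qed
  next
    case False
    with mult.prems have "\<alpha> \<in> Poly_Mapping.keys m"
      by (auto simp: keys_add_nat)
    with mult.IH obtain \<beta> m' p' where IH: "\<alpha> \<in> L" "\<beta> \<in> L" "incomparable \<alpha> \<beta>" "binomial_product L m' p'"
        "m = var_monomial \<alpha> + var_monomial \<beta> + m'" "p = lattice_binomial \<alpha> \<beta> * p'" by blast
    have "binomial_product L (var_monomial \<gamma> + var_monomial \<delta> + m') (lattice_binomial \<gamma> \<delta> * p')"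
      using mult.hyps IH(4) by (intro binomial_product.mult)
    then show ?thesis
      using IH by (intro exI[of _ \<beta>] exI[of _ "var_monomial \<gamma> + var_monomial \<delta> + m'"]
          exI[of _ "lattice_binomial \<gamma> \<delta> * p'"]) (simp add: ac_simps)
  qed
qed

lemma binomial_product_mult:
  "binomial_product L m p \<Longrightarrow> binomial_product L m' p' \<Longrightarrow> binomial_product L (m + m') (p * p')"
proof (induction rule: binomial_product.induct)
  case one
  then show ?case by simp
next
  case (mult \<alpha> \<beta> m p)
  then have "binomial_product L (var_monomial \<alpha> + var_monomial \<beta> + (m + m')) (lattice_binomial \<alpha> \<beta> * (p * p'))"
    by (intro binomial_product.mult)
  then show ?case by (simp add: ac_simps)
qed

lemma incomparable_monomials_iff_binomial_product:
  "m \<in> incomparable_monomials L \<longleftrightarrow> (\<exists>p :: ('a set, 'k::field) mpoly. binomial_product L m p)"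
proof
  show "m \<in> incomparable_monomials L \<Longrightarrow> \<exists>p :: ('a set, 'k) mpoly. binomial_product L m p"
    by (induction rule: incomparable_monomials.induct) (blast intro: binomial_product.intros)+
next
  assume "\<exists>p :: ('a set, 'k) mpoly. binomial_product L m p"
  then obtain p :: "('a set, 'k) mpoly" where "binomial_product L m p" ..
  then show "m \<in> incomparable_monomials L"
    by (induction rule: binomial_product.induct) (blast intro: incomparable_monomials.intros)+
qed

lemma binomial_product_in_algebra:
  "binomial_product L m p \<Longrightarrow> p \<in> lattice_algebra L"
  unfolding lattice_algebra_def
proof (induction rule: binomial_product.induct)
  case one
  show ?case by (intro is_subalgebra_one is_subalgebra_generated)
next
  case (mult \<alpha> \<beta> m p)
  have "lattice_binomial \<alpha> \<beta> \<in> subalgebra_generated (lattice_binomials L)"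
    using mult.hyps by (intro subalgebra_generated_base) (auto simp: lattice_binomials_def)
  then show ?case
    using mult.IH by (intro is_subalgebra_mult[OF is_subalgebra_generated])
qed

lemma mscale_mult_left: "mscale c p * q = mscale c (p * q)"
  by (simp add: mscale_def mult.assoc)

lemma mscale_mult_right: "q * mscale c p = mscale c (q * p)"
  by (simp add: mscale_def ac_simps)

lemma span_mult:
  assumes "p \<in> mpoly.span S" "q \<in> mpoly.span T" "\<And>a b. a \<in> S \<Longrightarrow> b \<in> T \<Longrightarrow> a * b \<in> mpoly.span U"
  shows "p * q \<in> mpoly.span U"
  using assms(1)
proof (induction rule: mpoly.span_induct_alt)
  case base
  then show ?case by (simp add: mpoly.span_zero)
next
  case (step c a p)
  have "a * q \<in> mpoly.span U"
    using assms(2)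
  proof (induction rule: mpoly.span_induct_alt)
    case base
    then show ?case by (simp add: mpoly.span_zero)
  next
    case (step d b q)
    then show ?case
      using assms(3) \<open>a \<in> S\<close>
      by (simp add: distrib_left mscale_mult_right mpoly.span_add mpoly.span_scale)
  qed
  with step show ?case
    by (simp add: distrib_right mscale_mult_left mpoly.span_add mpoly.span_scale)
qed

lemma lattice_algebra_subset_span:
  "(lattice_algebra L :: ('a set, 'k::field) mpoly set) \<subseteq> mpoly.span {p. \<exists>m. binomial_product L m p}"
  unfolding lattice_algebra_def
proof (rule subalgebra_generated_minimal)
  let ?B = "{p :: ('a set, 'k) mpoly. \<exists>m. binomial_product L m p}"
  have "Poly_Mapping.single 0 c \<in> mpoly.span ?B" for c :: 'k
  proof -
    have "Poly_Mapping.single 0 c = mscale c (1 :: ('a set, 'k) mpoly)"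
      by (simp add: mscale_def)
    moreover have "1 \<in> ?B"
      by (blast intro: binomial_product.one)
    ultimately show ?thesis
      by (simp only: mpoly.span_scale mpoly.span_base)
  qed
  moreover have "p * q \<in> mpoly.span ?B" if "p \<in> mpoly.span ?B" "q \<in> mpoly.span ?B" for p q
    using that by (rule span_mult) (blast intro: binomial_product_mult mpoly.span_base)
  ultimately show "is_subalgebra (mpoly.span ?B)"
    by (simp add: is_subalgebra_def mpoly.span_add)
  have "lattice_binomial \<alpha> \<beta> \<in> mpoly.span ?B" if "\<alpha> \<in> L" "\<beta> \<in> L" "incomparable \<alpha> \<beta>" for \<alpha> \<beta>
    using binomial_product.mult[OF that binomial_product.one]
    by (intro mpoly.span_base) auto
  then show "lattice_binomials L \<subseteq> mpoly.span ?B"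
    by (auto simp: lattice_binomials_def)
qed


section \<open>Lattices of width two\<close>

text \<open>
  The weight \<open>w\<close> makes the first term of every lattice binomial the heavier one. It is a natural
  number, so that the straightening of products of binomials terminates.
\<close>

locale narrow_lattice =
  fixes L :: "'a set set" and w :: "'a set \<Rightarrow> nat"
  assumes finite_L: "finite L"
    and Int_closed: "\<And>\<alpha> \<beta>. \<alpha> \<in> L \<Longrightarrow> \<beta> \<in> L \<Longrightarrow> \<alpha> \<inter> \<beta> \<in> L"
    and Un_closed: "\<And>\<alpha> \<beta>. \<alpha> \<in> L \<Longrightarrow> \<beta> \<in> L \<Longrightarrow> \<alpha> \<union> \<beta> \<in> L"
    and weight_decreases: "\<And>\<alpha> \<beta>. \<alpha> \<in> L \<Longrightarrow> \<beta> \<in> L \<Longrightarrow> incomparable \<alpha> \<beta> \<Longrightarrow>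
      w (\<alpha> \<inter> \<beta>) + w (\<alpha> \<union> \<beta>) < w \<alpha> + w \<beta>"
    and width_two: "\<And>\<alpha> \<beta> \<gamma>. \<alpha> \<in> L \<Longrightarrow> \<beta> \<in> L \<Longrightarrow> \<gamma> \<in> L \<Longrightarrow>
      incomparable \<alpha> \<beta> \<Longrightarrow> incomparable \<alpha> \<gamma> \<Longrightarrow> \<not> incomparable \<beta> \<gamma>"
begin

abbreviation wt :: "('a set \<Rightarrow>\<^sub>0 nat) \<Rightarrow> nat" where
  "wt \<equiv> monomial_weight L w"

definition lower :: "nat \<Rightarrow> ('a set \<Rightarrow>\<^sub>0 nat) set" where
  "lower n = {m \<in> monomials_in L. wt m < n}"

lemma lattice_binomial_tail:
  assumes "\<alpha> \<in> L" "\<beta> \<in> L" "incomparable \<alpha> \<beta>"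
  shows "lattice_binomial \<alpha> \<beta> - Poly_Mapping.single (var_monomial \<alpha> + var_monomial \<beta>) 1
    \<in> supported_on (lower (w \<alpha> + w \<beta>))"
  using assms weight_decreases[OF assms] Int_closed Un_closed finite_L
  by (auto simp: lattice_binomial_def mvar_mult_mvar lower_def intro!: supported_on_uminus supported_on_single)

lemma binomial_product_monomial: "binomial_product L m p \<Longrightarrow> m \<in> monomials_in L"
  by (induction rule: binomial_product.induct) simp_all

text \<open>
  The recorded monomial is the leading one for every order that refines the weight.
\<close>

lemma binomial_product_tail:
  "binomial_product L m p \<Longrightarrow> p - Poly_Mapping.single m 1 \<in> supported_on (lower (wt m))"
proof (induction rule: binomial_product.induct)
  case one
  then show ?case by simp
next
  case (mult \<alpha> \<beta> m p)
  let ?ab = "var_monomial \<alpha> + var_monomial \<beta>"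
  let ?s = "Poly_Mapping.single ?ab 1" and ?t = "Poly_Mapping.single m 1"
  let ?f = "lattice_binomial \<alpha> \<beta>"
  have m: "m \<in> monomials_in L"
    using mult.hyps(4) by (rule binomial_product_monomial)
  have wt_ab: "wt ?ab = w \<alpha> + w \<beta>"
    using mult.hyps finite_L by simp
  have tail: "?f - ?s \<in> supported_on (lower (w \<alpha> + w \<beta>))"
    using mult.hyps(1-3) by (rule lattice_binomial_tail)
  have "p = (p - ?t) + ?t" by simp
  also have "\<dots> \<in> supported_on {m' \<in> monomials_in L. wt m' \<le> wt m}"
    by (intro supported_on_add supported_on_mono[OF _ mult.IH] supported_on_single)
       (use m in \<open>auto simp: lower_def\<close>)
  finally have "(?f - ?s) * p \<in> supported_on (lower (wt (?ab + m)))"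
    by (rule supported_on_mult[OF tail]) (use wt_ab in \<open>auto simp: lower_def\<close>)
  moreover have "?s * (p - ?t) \<in> supported_on (lower (wt (?ab + m)))"
    by (rule supported_on_mult[OF supported_on_single[of _ "{?ab}"] mult.IH])
       (use mult.hyps finite_L in \<open>auto simp: lower_def\<close>)
  moreover have "?f * p - Poly_Mapping.single (?ab + m) 1 = (?f - ?s) * p + ?s * (p - ?t)"
    by (simp add: left_diff_distrib right_diff_distrib mult_single)
  ultimately show ?case
    by (simp only: supported_on_add)
qed

text \<open>
  The assumption \<open>rail\<close> says that \<open>\<alpha>\<close> and \<open>\<gamma>\<close> lie on the lower rail of a ladder and \<open>\<beta>\<close> and \<open>\<delta>\<close>
  on its upper rail. Together with \<open>\<alpha> \<inter> \<delta>\<close> on the lower rail and \<open>\<alpha> \<union> \<delta>\<close> on the upper one they span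
  the columns of a matrix with two rows, the binomials are its minors, and the identity is the
  three-term Pluecker relation.
\<close>

lemma pluecker_relation:
  assumes in_L: "\<alpha> \<in> L" "\<beta> \<in> L" "\<gamma> \<in> L" "\<delta> \<in> L"
    and chains: "\<alpha> \<subset> \<gamma>" "\<beta> \<subset> \<delta>"
    and incomp: "incomparable \<alpha> \<beta>" "incomparable \<alpha> \<delta>" "incomparable \<gamma> \<beta>" "incomparable \<gamma> \<delta>"
    and rail: "\<delta> \<subseteq> \<alpha> \<union> \<beta>" "\<gamma> \<inter> \<delta> \<subseteq> \<alpha>"
  shows "\<exists>\<epsilon> \<zeta> \<eta> \<theta>. \<epsilon> \<in> L \<and> \<zeta> \<in> L \<and> \<eta> \<in> L \<and> \<theta> \<in> L \<and> incomparable \<epsilon> \<zeta> \<and> incomparable \<eta> \<theta> \<and>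
    w \<epsilon> + w \<zeta> + (w \<eta> + w \<theta>) < w \<alpha> + w \<beta> + (w \<gamma> + w \<delta>) \<and>
    lattice_binomial \<alpha> \<beta> * lattice_binomial \<gamma> \<delta> - lattice_binomial \<alpha> \<delta> * lattice_binomial \<gamma> \<beta>
      = (lattice_binomial \<epsilon> \<zeta> * lattice_binomial \<eta> \<theta> :: ('a set, 'k::field) mpoly)"
proof (rule exI[of _ \<gamma>], rule exI[of _ "\<alpha> \<union> \<delta>"], rule exI[of _ \<beta>], rule exI[of _ "\<alpha> \<inter> \<delta>"], intro conjI)
  let ?A = "\<alpha> \<inter> \<delta>" and ?C = "\<alpha> \<union> \<delta>"
  have meets: "\<gamma> \<inter> \<delta> = ?A" "\<gamma> \<inter> \<beta> = \<alpha> \<inter> \<beta>" "\<gamma> \<inter> ?C = \<alpha>" "\<beta> \<inter> ?A = \<alpha> \<inter> \<beta>"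
    and joins: "\<alpha> \<union> \<beta> = ?C" "\<gamma> \<union> \<beta> = \<gamma> \<union> \<delta>" "\<gamma> \<union> ?C = \<gamma> \<union> \<delta>" "\<beta> \<union> ?A = \<delta>"
    using chains rail by blast+
  show "?A \<in> L" "?C \<in> L" "\<gamma> \<in> L" "\<beta> \<in> L"
    using in_L Int_closed Un_closed by auto
  show "incomparable \<gamma> ?C" "incomparable \<beta> ?A"
    using chains rail incomp unfolding incomparable_def by blast+
  show "w \<gamma> + w ?C + (w \<beta> + w ?A) < w \<alpha> + w \<beta> + (w \<gamma> + w \<delta>)"
    using weight_decreases[OF in_L(1,4) incomp(2)] by simp
  show "lattice_binomial \<alpha> \<beta> * lattice_binomial \<gamma> \<delta> - lattice_binomial \<alpha> \<delta> * lattice_binomial \<gamma> \<beta>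
      = (lattice_binomial \<gamma> ?C * lattice_binomial \<beta> ?A :: ('a set, 'k) mpoly)"
    unfolding lattice_binomial_def meets joins by (simp add: algebra_simps)
qed

text \<open>
  In width two \<open>\<alpha> \<union> \<beta>\<close> is comparable to \<open>\<gamma>\<close> or \<open>\<delta>\<close>, and \<open>\<gamma> \<inter> \<delta>\<close> is comparable to \<open>\<alpha>\<close> or \<open>\<beta>\<close>.
  This decides which of the two chains is the lower rail, and the relation is symmetric in the
  two chains.
\<close>

lemma exchange_relation:
  assumes in_L: "\<alpha> \<in> L" "\<beta> \<in> L" "\<gamma> \<in> L" "\<delta> \<in> L"
    and chains: "\<alpha> \<subset> \<gamma>" "\<beta> \<subset> \<delta>"
    and incomp: "incomparable \<alpha> \<beta>" "incomparable \<alpha> \<delta>" "incomparable \<gamma> \<beta>" "incomparable \<gamma> \<delta>"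
  shows "\<exists>\<epsilon> \<zeta> \<eta> \<theta>. \<epsilon> \<in> L \<and> \<zeta> \<in> L \<and> \<eta> \<in> L \<and> \<theta> \<in> L \<and> incomparable \<epsilon> \<zeta> \<and> incomparable \<eta> \<theta> \<and>
    w \<epsilon> + w \<zeta> + (w \<eta> + w \<theta>) < w \<alpha> + w \<beta> + (w \<gamma> + w \<delta>) \<and>
    lattice_binomial \<alpha> \<beta> * lattice_binomial \<gamma> \<delta> - lattice_binomial \<alpha> \<delta> * lattice_binomial \<gamma> \<beta>
      = (lattice_binomial \<epsilon> \<zeta> * lattice_binomial \<eta> \<theta> :: ('a set, 'k::field) mpoly)"
proof -
  have join: "\<gamma> \<subseteq> \<alpha> \<union> \<beta> \<or> \<delta> \<subseteq> \<alpha> \<union> \<beta>"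
  proof (rule ccontr)
    assume "\<not> ?thesis"
    then have "incomparable \<gamma> (\<alpha> \<union> \<beta>)" "incomparable \<delta> (\<alpha> \<union> \<beta>)"
      using incomp unfolding incomparable_def by blast+
    then show False
      using width_two[OF _ in_L(3,4), of "\<alpha> \<union> \<beta>"] in_L Un_closed incomp(4) incomparable_sym by metis
  qed
  have meet: "\<gamma> \<inter> \<delta> \<subseteq> \<alpha> \<or> \<gamma> \<inter> \<delta> \<subseteq> \<beta>"
  proof (rule ccontr)
    assume "\<not> ?thesis"
    then have "incomparable \<alpha> (\<gamma> \<inter> \<delta>)" "incomparable \<beta> (\<gamma> \<inter> \<delta>)"
      using incomp unfolding incomparable_def by blast+
    then show False
      using width_two[OF _ in_L(1,2), of "\<gamma> \<inter> \<delta>"] in_L Int_closed incomp(1) incomparable_sym by metis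
  qed
  consider "\<delta> \<subseteq> \<alpha> \<union> \<beta>" "\<gamma> \<inter> \<delta> \<subseteq> \<alpha>" | "\<gamma> \<subseteq> \<beta> \<union> \<alpha>" "\<delta> \<inter> \<gamma> \<subseteq> \<beta>"
    using join meet chains by blast
  then show ?thesis
  proof cases
    case 1
    then show ?thesis
      by (intro pluecker_relation assms)
  next
    case 2
    have "\<exists>\<epsilon> \<zeta> \<eta> \<theta>. \<epsilon> \<in> L \<and> \<zeta> \<in> L \<and> \<eta> \<in> L \<and> \<theta> \<in> L \<and> incomparable \<epsilon> \<zeta> \<and> incomparable \<eta> \<theta> \<and>
      w \<epsilon> + w \<zeta> + (w \<eta> + w \<theta>) < w \<beta> + w \<alpha> + (w \<delta> + w \<gamma>) \<and>
      lattice_binomial \<beta> \<alpha> * lattice_binomial \<delta> \<gamma> - lattice_binomial \<beta> \<gamma> * lattice_binomial \<delta> \<alpha>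
        = (lattice_binomial \<epsilon> \<zeta> * lattice_binomial \<eta> \<theta> :: ('a set, 'k) mpoly)"
      by (intro pluecker_relation assms incomparable_sym 2)
    then show ?thesis
      by (simp only: lattice_binomial_commute[of \<beta> \<alpha>] lattice_binomial_commute[of \<delta> \<gamma>]
          lattice_binomial_commute[of \<beta> \<gamma>] lattice_binomial_commute[of \<delta> \<alpha>] ac_simps)
  qed
qed

definition lower_span :: "nat \<Rightarrow> ('a set, 'k::field) mpoly set" where
  "lower_span n = mpoly.span {p. \<exists>m. binomial_product L m p \<and> wt m < n}"

lemma lower_spanI: "binomial_product L m p \<Longrightarrow> wt m < n \<Longrightarrow> p \<in> lower_span n"
  unfolding lower_span_def by (rule mpoly.span_base) blast

lemma lower_span_mult:
  fixes p q :: "('a set, 'k::field) mpoly"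
  assumes "binomial_product L m p" "q \<in> lower_span n"
  shows "p * q \<in> lower_span (wt m + n)"
proof -
  have "p \<in> mpoly.span {p}"
    by (rule mpoly.span_base) simp
  then show ?thesis
    using assms(2) unfolding lower_span_def
  proof (rule span_mult)
    fix a b :: "('a set, 'k) mpoly"
    assume "a \<in> {p}" "b \<in> {p. \<exists>m. binomial_product L m p \<and> wt m < n}"
    then obtain m' where "a = p" "binomial_product L m' b" "wt m' < n" by blast
    then have "binomial_product L (m + m') (a * b) \<and> wt (m + m') < wt m + n"
      using binomial_product_mult[OF assms(1)] by simp
    then show "a * b \<in> mpoly.span {p. \<exists>m'. binomial_product L m' p \<and> wt m' < wt m + n}"
      by (intro mpoly.span_base) blast
  qed
qed

lemma lower_span_add: "p \<in> lower_span n \<Longrightarrow> q \<in> lower_span n \<Longrightarrow> p + q \<in> lower_span n"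
  unfolding lower_span_def by (rule mpoly.span_add)

lemma lower_span_uminus: "p \<in> lower_span n \<Longrightarrow> - p \<in> lower_span n"
  unfolding lower_span_def by (rule mpoly.span_neg)

lemma lower_span_0: "0 \<in> lower_span n"
  unfolding lower_span_def by (rule mpoly.span_zero)

text \<open>
  The partner \<open>\<gamma>\<close> of \<open>\<beta>\<close> in the remaining product is either \<open>\<alpha>\<close>, and then there is nothing to
  exchange, or it is above \<open>\<alpha>\<close> by minimality of \<open>\<alpha>\<close>. Then \<open>\<gamma>\<close> is incomparable to \<open>\<delta>\<close> as well, and the
  pairs \<open>{\<alpha>, \<delta>}\<close> and \<open>{\<beta>, \<gamma>}\<close> can be exchanged for \<open>{\<alpha>, \<beta>}\<close> and \<open>{\<gamma>, \<delta>}\<close>. It is essential that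
  the smaller \<open>\<beta>\<close> of two possible partners of \<open>\<alpha>\<close> is the new one.
\<close>

lemma exchange_partner:
  fixes q :: "('a set, 'k::field) mpoly"
  assumes minimal: "\<And>\<gamma>. \<gamma> \<in> Poly_Mapping.keys m \<Longrightarrow> \<gamma> \<subseteq> \<alpha> \<Longrightarrow> \<gamma> = \<alpha>"
    and in_L: "\<alpha> \<in> L" "\<beta> \<in> L" "\<delta> \<in> L"
    and incomp: "incomparable \<alpha> \<beta>" "incomparable \<alpha> \<delta>" and "\<beta> \<subset> \<delta>"
    and m: "m = var_monomial \<alpha> + var_monomial \<delta> + m'" "\<beta> \<in> Poly_Mapping.keys m"
    and q: "binomial_product L m' q"
  shows "\<exists>m1 q1. m = var_monomial \<alpha> + var_monomial \<beta> + m1 \<and> binomial_product L m1 q1 \<and>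
    lattice_binomial \<alpha> \<beta> * q1 - lattice_binomial \<alpha> \<delta> * q \<in> lower_span (wt m)"
proof -
  have "\<beta> \<noteq> \<alpha>" "\<beta> \<noteq> \<delta>"
    using incomp \<open>\<beta> \<subset> \<delta>\<close> by (auto simp: incomparable_def)
  then have "\<beta> \<in> Poly_Mapping.keys m'"
    using m by (auto simp: keys_add_nat)
  from binomial_product_split[OF q this] obtain \<gamma> m2 q2 where \<gamma>: "\<gamma> \<in> L" "incomparable \<beta> \<gamma>"
    and q2: "binomial_product L m2 q2" and m': "m' = var_monomial \<beta> + var_monomial \<gamma> + m2"
    and q_eq: "q = lattice_binomial \<beta> \<gamma> * q2" by blast
  show ?thesis
  proof (cases "\<gamma> = \<alpha>")
    case True
    have "binomial_product L (var_monomial \<alpha> + var_monomial \<delta> + m2) (lattice_binomial \<alpha> \<delta> * q2)"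
      by (intro binomial_product.mult in_L incomp q2)
    moreover have "m = var_monomial \<alpha> + var_monomial \<beta> + (var_monomial \<alpha> + var_monomial \<delta> + m2)"
      by (simp add: m m' True ac_simps)
    moreover have "lattice_binomial \<alpha> \<beta> * (lattice_binomial \<alpha> \<delta> * q2) - lattice_binomial \<alpha> \<delta> * q = 0"
      by (simp add: q_eq True lattice_binomial_commute[of \<beta> \<alpha>])
    ultimately show ?thesis
      by (intro exI[of _ "var_monomial \<alpha> + var_monomial \<delta> + m2"] exI[of _ "lattice_binomial \<alpha> \<delta> * q2"])
         (simp only: lower_span_0 simp_thms)
  next
    case False
    have "\<gamma> \<in> Poly_Mapping.keys m"
      using m m' by (simp add: keys_add_nat)
    then have "\<not> \<gamma> \<subseteq> \<alpha>"
      using minimal False by blast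
    moreover have "\<not> incomparable \<alpha> \<gamma>"
      using width_two[OF in_L(2,1) \<gamma>(1) incomparable_sym[OF incomp(1)] \<gamma>(2)] .
    ultimately have "\<alpha> \<subset> \<gamma>"
      by (auto simp: incomparable_def)
    have incomp': "incomparable \<gamma> \<beta>" "incomparable \<gamma> \<delta>"
      using \<gamma>(2) \<open>\<alpha> \<subset> \<gamma>\<close> \<open>\<beta> \<subset> \<delta>\<close> incomp by (auto simp: incomparable_def)
    obtain \<epsilon> \<zeta> \<eta> \<theta> where new: "\<epsilon> \<in> L" "\<zeta> \<in> L" "incomparable \<epsilon> \<zeta>" "\<eta> \<in> L" "\<theta> \<in> L" "incomparable \<eta> \<theta>"
      and less: "w \<epsilon> + w \<zeta> + (w \<eta> + w \<theta>) < w \<alpha> + w \<beta> + (w \<gamma> + w \<delta>)"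
      and rel: "lattice_binomial \<alpha> \<beta> * lattice_binomial \<gamma> \<delta> - lattice_binomial \<alpha> \<delta> * lattice_binomial \<gamma> \<beta>
        = (lattice_binomial \<epsilon> \<zeta> * lattice_binomial \<eta> \<theta> :: ('a set, 'k) mpoly)"
      using exchange_relation[where ?'k = 'k, OF in_L(1,2) \<gamma>(1) in_L(3) \<open>\<alpha> \<subset> \<gamma>\<close> \<open>\<beta> \<subset> \<delta>\<close> incomp incomp']
      by blast
    have "binomial_product L (var_monomial \<epsilon> + var_monomial \<zeta> + (var_monomial \<eta> + var_monomial \<theta> + m2))
        (lattice_binomial \<epsilon> \<zeta> * (lattice_binomial \<eta> \<theta> * q2))"
      by (intro binomial_product.mult new q2)
    moreover have "wt (var_monomial \<epsilon> + var_monomial \<zeta> + (var_monomial \<eta> + var_monomial \<theta> + m2)) < wt m"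
      using less new in_L \<gamma>(1) finite_L by (simp add: m m')
    ultimately have "lattice_binomial \<epsilon> \<zeta> * (lattice_binomial \<eta> \<theta> * q2) \<in> lower_span (wt m)"
      by (rule lower_spanI)
    also have "lattice_binomial \<epsilon> \<zeta> * (lattice_binomial \<eta> \<theta> * q2)
        = (lattice_binomial \<alpha> \<beta> * lattice_binomial \<gamma> \<delta> - lattice_binomial \<alpha> \<delta> * lattice_binomial \<gamma> \<beta>) * q2"
      by (simp only: rel mult.assoc)
    also have "\<dots> = lattice_binomial \<alpha> \<beta> * (lattice_binomial \<gamma> \<delta> * q2) - lattice_binomial \<alpha> \<delta> * q"
      by (simp add: q_eq lattice_binomial_commute[of \<beta> \<gamma>] left_diff_distrib mult.assoc)
    finally have "lattice_binomial \<alpha> \<beta> * (lattice_binomial \<gamma> \<delta> * q2) - lattice_binomial \<alpha> \<delta> * q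
        \<in> lower_span (wt m)" .
    moreover have "binomial_product L (var_monomial \<gamma> + var_monomial \<delta> + m2) (lattice_binomial \<gamma> \<delta> * q2)"
      by (intro binomial_product.mult \<gamma> in_L incomp' q2)
    moreover have "m = var_monomial \<alpha> + var_monomial \<beta> + (var_monomial \<gamma> + var_monomial \<delta> + m2)"
      by (simp add: m m' ac_simps)
    ultimately show ?thesis by blast
  qed
qed

text \<open>
  Induction on the degree. A minimal variable \<open>\<alpha>\<close> of \<open>m\<close> has partners \<open>\<beta>\<close> and \<open>\<delta>\<close> in the two products,
  and these are comparable in width two. An exchange in the product with the larger partner makes
  the partners equal, and the common factor can be split off.
\<close>

lemma binomial_products_agree_modulo_lower:
  fixes p q :: "('a set, 'k::field) mpoly"
  assumes "binomial_product L m p" "binomial_product L m q"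
  shows "p - q \<in> lower_span (wt m)"
  using assms
proof (induction "monomial_weight L (\<lambda>_. 1) m" arbitrary: m p q rule: less_induct)
  case less
  show ?case
  proof (cases "Poly_Mapping.keys m = {}")
    case True
    then have "p = 1" "q = 1"
      using less.prems binomial_product_0 by blast+
    then show ?thesis by (simp add: lower_span_0)
  next
    case False
    from finite_has_minimal[OF finite_keys this]
    obtain \<alpha> where \<alpha>: "\<alpha> \<in> Poly_Mapping.keys m"
      and min: "\<forall>\<gamma>\<in>Poly_Mapping.keys m. \<gamma> \<subseteq> \<alpha> \<longrightarrow> \<alpha> = \<gamma>" ..
    have minimal: "\<gamma> = \<alpha>" if "\<gamma> \<in> Poly_Mapping.keys m" "\<gamma> \<subseteq> \<alpha>" for \<gamma>
      using bspec[OF min that(1)] that(2) by simp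
    have same: "lattice_binomial \<alpha> \<beta> * p' - lattice_binomial \<alpha> \<beta> * q' \<in> lower_span (wt m)"
      if "\<alpha> \<in> L" "\<beta> \<in> L" "incomparable \<alpha> \<beta>" "m = var_monomial \<alpha> + var_monomial \<beta> + m'"
        "binomial_product L m' p'" "binomial_product L m' q'" for \<beta> m' and p' q' :: "('a set, 'k) mpoly"
    proof -
      have "p' - q' \<in> lower_span (wt m')"
        using that finite_L by (intro less.hyps) simp_all
      moreover have "binomial_product L (var_monomial \<alpha> + var_monomial \<beta> + 0) (lattice_binomial \<alpha> \<beta> * (1 :: ('a set, 'k) mpoly))"
        by (intro binomial_product.intros that)
      ultimately have "lattice_binomial \<alpha> \<beta> * (p' - q') \<in> lower_span (wt m)"
        using lower_span_mult[of "var_monomial \<alpha> + var_monomial \<beta>" "lattice_binomial \<alpha> \<beta>" "p' - q'" "wt m'"]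
          that(4) by simp
      then show ?thesis by (simp add: right_diff_distrib)
    qed
    have ordered: "lattice_binomial \<alpha> \<beta> * p' - lattice_binomial \<alpha> \<delta> * q' \<in> lower_span (wt m)"
      if h: "\<alpha> \<in> L" "\<beta> \<in> L" "\<delta> \<in> L" "incomparable \<alpha> \<beta>" "incomparable \<alpha> \<delta>" "\<beta> \<subseteq> \<delta>"
        "m = var_monomial \<alpha> + var_monomial \<beta> + m1" "m = var_monomial \<alpha> + var_monomial \<delta> + m2"
        "binomial_product L m1 p'" "binomial_product L m2 q'"
      for \<beta> \<delta> m1 m2 and p' q' :: "('a set, 'k) mpoly"
    proof (cases "\<beta> = \<delta>")
      case True
      with h have "m1 = m2" by simp
      with True h same[of \<beta> m1 p' q'] show ?thesis by simp
    next
      case False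
      have \<beta>: "\<beta> \<subset> \<delta>" "\<beta> \<in> Poly_Mapping.keys m"
        using False h(6,7) by (auto simp: keys_add_nat)
      from exchange_partner[OF minimal h(1-5) \<beta>(1) h(8) \<beta>(2) h(10)]
      obtain m3 q3 where m3: "m = var_monomial \<alpha> + var_monomial \<beta> + m3"
        and q3: "binomial_product L m3 q3"
        and diff: "lattice_binomial \<alpha> \<beta> * q3 - lattice_binomial \<alpha> \<delta> * q' \<in> lower_span (wt m)"
        by blast
      have "m1 = m3"
        using h(7) m3 by simp
      with h q3 have "lattice_binomial \<alpha> \<beta> * p' - lattice_binomial \<alpha> \<beta> * q3 \<in> lower_span (wt m)"
        by (intro same[of \<beta> m3]) simp_all
      from lower_span_add[OF this diff] show ?thesis by simp
    qed
    obtain \<beta> m1 p' where p': "\<alpha> \<in> L" "\<beta> \<in> L" "incomparable \<alpha> \<beta>" "binomial_product L m1 p'"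
        "m = var_monomial \<alpha> + var_monomial \<beta> + m1" "p = lattice_binomial \<alpha> \<beta> * p'"
      using binomial_product_split[OF less.prems(1) \<alpha>] by blast
    obtain \<delta> m2 q' where q': "\<delta> \<in> L" "incomparable \<alpha> \<delta>" "binomial_product L m2 q'"
        "m = var_monomial \<alpha> + var_monomial \<delta> + m2" "q = lattice_binomial \<alpha> \<delta> * q'"
      using binomial_product_split[OF less.prems(2) \<alpha>] by blast
    have "\<not> incomparable \<beta> \<delta>"
      using width_two[OF p'(1,2) q'(1) p'(3) q'(2)] .
    then consider "\<beta> \<subseteq> \<delta>" | "\<delta> \<subseteq> \<beta>"
      by (auto simp: incomparable_def)
    then show ?thesis
    proof cases
      case 1
      then show ?thesis
        unfolding p'(6) q'(5) by (rule ordered[OF p'(1,2) q'(1) p'(3) q'(2) _ p'(5) q'(4) p'(4) q'(3)])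
    next
      case 2
      then have "q - p \<in> lower_span (wt m)"
        unfolding p'(6) q'(5) by (rule ordered[OF p'(1) q'(1) p'(2) q'(2) p'(3) _ q'(4) p'(5) q'(3) p'(4)])
      from lower_span_uminus[OF this] show ?thesis by simp
    qed
  qed
qed

text \<open>One product of binomials for each monomial suffices to span the algebra.\<close>

definition chosen_product :: "('a set \<Rightarrow>\<^sub>0 nat) \<Rightarrow> ('a set, 'k::field) mpoly" where
  "chosen_product m = (SOME p. binomial_product L m p)"

lemma binomial_product_chosen:
  assumes "m \<in> incomparable_monomials L"
  shows "binomial_product L m (chosen_product m :: ('a set, 'k::field) mpoly)"
  unfolding chosen_product_def
  by (rule someI_ex) (rule incomparable_monomials_iff_binomial_product[THEN iffD1, OF assms])

lemma binomial_product_in_span_chosen: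
  fixes p :: "('a set, 'k::field) mpoly"
  assumes "binomial_product L m p"
  shows "p \<in> mpoly.span (chosen_product ` incomparable_monomials L)"
  using assms
proof (induction "wt m" arbitrary: m p rule: less_induct)
  case less
  let ?S = "mpoly.span (chosen_product ` incomparable_monomials L) :: ('a set, 'k) mpoly set"
  have m: "m \<in> incomparable_monomials L"
    using less.prems incomparable_monomials_iff_binomial_product by blast
  have "lower_span (wt m) \<subseteq> ?S"
    unfolding lower_span_def using less.hyps by (intro mpoly.span_minimal) auto
  then have "p - chosen_product m \<in> ?S"
    using binomial_products_agree_modulo_lower[OF less.prems binomial_product_chosen[OF m]] by blast
  moreover have "chosen_product m \<in> ?S"
    using m by (intro mpoly.span_base) blast
  ultimately show ?case
    using mpoly.span_add[of "p - chosen_product m" _ "chosen_product m"] by simp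
qed

text \<open>
  Written in terms of the chosen products, \<open>f\<close> has the recorded monomials of maximal weight as its
  heaviest monomials: these are distinct, and the tails of the products are lighter.
\<close>

lemma leading_monomial_in_incomparable_monomials:
  fixes f :: "('a set, 'k::field) mpoly"
  assumes f: "f \<in> lattice_algebra L" "f \<noteq> 0"
    and ord: "linear_order_on (monomials_in L) ord"
    and refines: "\<And>a b. a \<in> monomials_in L \<Longrightarrow> b \<in> monomials_in L \<Longrightarrow> wt a < wt b \<Longrightarrow> (a, b) \<in> ord"
  shows "leading_monomial ord f \<in> incomparable_monomials L"
proof -
  let ?N = "chosen_product :: _ \<Rightarrow> ('a set, 'k) mpoly" and ?I = "incomparable_monomials L"
  have "{p. \<exists>m. binomial_product L m p} \<subseteq> mpoly.span (?N ` ?I)"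
    using binomial_product_in_span_chosen by blast
  from mpoly.span_minimal[OF this mpoly.subspace_span]
  have "f \<in> mpoly.span (?N ` ?I)"
    using subsetD[OF lattice_algebra_subset_span f(1)] by (rule subsetD)
  then obtain T c where T: "finite T" "T \<subseteq> ?N ` ?I" and f_eq: "f = (\<Sum>p\<in>T. mscale (c p) p)"
    unfolding mpoly.span_explicit by blast
  define T' where "T' = {p \<in> T. c p \<noteq> 0}"
  have "f = (\<Sum>p\<in>T'. mscale (c p) p)"
    unfolding f_eq T'_def using T(1) by (intro sum.mono_neutral_right) (auto simp: mscale_def)
  moreover obtain U where U: "U \<subseteq> ?I" "inj_on ?N U" "T' = ?N ` U"
  proof -
    have "T' \<subseteq> ?N ` ?I"
      using T(2) by (auto simp: T'_def)
    then show ?thesis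
      unfolding subset_image_inj using that by (elim exE conjE)
  qed
  ultimately have f_sum: "f = (\<Sum>m\<in>U. mscale (c (?N m)) (?N m))"
    by (simp only: sum.reindex o_def)
  have "finite U"
  proof (rule finite_imageD[OF _ U(2)])
    show "finite (?N ` U)"
      unfolding U(3)[symmetric] T'_def using T(1) by simp
  qed
  have coeff: "c (?N m) \<noteq> 0" if "m \<in> U" for m
    using that U(3) by (auto simp: T'_def)
  have "U \<noteq> {}"
    using f(2) f_sum by auto
  define W where "W = Max (wt ` U)"
  have wt_le: "wt m \<le> W" if "m \<in> U" for m
    using that \<open>finite U\<close> by (simp add: W_def)
  have "W \<in> wt ` U"
    unfolding W_def using \<open>finite U\<close> \<open>U \<noteq> {}\<close> by (intro Max_in) simp_all
  then obtain m0 where m0: "m0 \<in> U" "wt m0 = W" by auto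
  have product: "binomial_product L m (?N m)" if "m \<in> U" for m
    using subsetD[OF U(1) that] by (rule binomial_product_chosen)
  define heads where "heads = (\<Sum>m\<in>U. Poly_Mapping.single m (c (?N m)))"
  have "f - heads = (\<Sum>m\<in>U. mscale (c (?N m)) (?N m - Poly_Mapping.single m 1))"
    unfolding f_sum heads_def
    by (simp only: mpoly.scale_right_diff_distrib mscale_single sum_subtractf mult_1_right)
  also have "\<dots> \<in> supported_on (lower W)"
  proof (rule mpoly.subspace_sum[OF subspace_supported_on])
    fix m assume m: "m \<in> U"
    have "lower (wt m) \<subseteq> lower W"
      using wt_le[OF m] by (auto simp: lower_def)
    then have "?N m - Poly_Mapping.single m 1 \<in> supported_on (lower W)"
      using binomial_product_tail[OF product[OF m]] by (rule supported_on_mono)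
    then show "mscale (c (?N m)) (?N m - Poly_Mapping.single m 1) \<in> supported_on (lower W)"
      by (rule mpoly.subspace_scale[OF subspace_supported_on])
  qed
  finally have tail: "f - heads \<in> supported_on (lower W)" .
  have lookup_heads: "Poly_Mapping.lookup heads m = (if m \<in> U then c (?N m) else 0)" for m
    using \<open>finite U\<close> by (simp add: heads_def lookup_sum lookup_single when_def sum.delta)
  have split: "Poly_Mapping.lookup f m = Poly_Mapping.lookup (f - heads) m + Poly_Mapping.lookup heads m" for m
    by (simp add: lookup_minus)
  have "m0 \<notin> lower W"
    using m0 by (simp add: lower_def)
  then have "m0 \<notin> Poly_Mapping.keys (f - heads)"
    using supported_onD[OF tail] by blast
  then have "m0 \<in> Poly_Mapping.keys f"
    using split[of m0] lookup_heads[of m0] coeff[OF m0(1)] m0(1) by (simp add: in_keys_iff)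
  let ?l = "leading_monomial ord f"
  have f_supp: "f \<in> supported_on (monomials_in L)"
    using lattice_algebra_supported_on[OF Int_closed Un_closed] f(1) by blast
  have l: "?l \<in> Poly_Mapping.keys f" "(m0, ?l) \<in> ord"
    using leading_monomial_greatest[OF ord f_supp f(2)] \<open>m0 \<in> Poly_Mapping.keys f\<close> by blast+
  show ?thesis
  proof (rule ccontr)
    assume "?l \<notin> ?I"
    then have "?l \<notin> U"
      using U(1) by blast
    then have "?l \<in> Poly_Mapping.keys (f - heads)"
      using l(1) split[of ?l] lookup_heads[of ?l] by (simp add: in_keys_iff)
    then have "?l \<in> lower W"
      using supported_onD[OF tail] by blast
    then have "(?l, m0) \<in> ord"
      using m0 refines[of ?l m0] binomial_product_monomial[OF product[OF m0(1)]]
      by (simp add: lower_def)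
    then have "?l = m0"
      using l(2) ord by (intro antisymD[of ord]) (simp_all add: order_on_defs)
    then show False
      using \<open>?l \<notin> U\<close> m0(1) by simp
  qed
qed

lemma ex_khovanskii_basis:
  "\<exists>ord. compatible_order TYPE('k::field) L ord \<and>
     khovanskii_basis ord (lattice_algebra L :: ('a set, 'k) mpoly set) (lattice_binomials L)"
proof -
  from monomial_order_refining_weight[OF finite_L, of w]
  obtain ord where mono: "monomial_order L ord"
    and ref: "\<forall>a\<in>monomials_in L. \<forall>b\<in>monomials_in L. wt a < wt b \<longrightarrow> (a, b) \<in> ord"
    by (elim exE conjE)
  have refines: "(a, b) \<in> ord" if "a \<in> monomials_in L" "b \<in> monomials_in L" "wt a < wt b" for a b
    using ref that by blast
  have lin: "linear_order_on (monomials_in L) ord"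
    using mono by (simp add: monomial_order_def)
  have lead: "leading_monomial ord p = m \<and> Poly_Mapping.lookup p m = 1"
    if "binomial_product L m p" for m and p :: "('a set, 'k) mpoly"
  proof -
    let ?t = "p - Poly_Mapping.single m 1"
    have tail: "m' \<in> lower (wt m)" if "m' \<in> Poly_Mapping.keys ?t" for m'
      using supported_onD[OF binomial_product_tail[OF \<open>binomial_product L m p\<close>] that] .
    have "m \<notin> Poly_Mapping.keys ?t"
      using tail[of m] by (auto simp: lower_def)
    then have one: "Poly_Mapping.lookup p m = 1"
      by (simp add: in_keys_iff lookup_minus)
    have m: "m \<in> monomials_in L"
      using that by (rule binomial_product_monomial)
    have "(m', m) \<in> ord" if "m' \<in> Poly_Mapping.keys p" for m'
    proof (cases "m' = m")
      case True
      then show ?thesis using lin m by (simp add: order_on_defs refl_on_def)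
    next
      case False
      then have "m' \<in> lower (wt m)"
        using that tail[of m'] by (simp add: in_keys_iff lookup_minus lookup_single when_def)
      then show ?thesis using refines m by (simp add: lower_def)
    qed
    then have "leading_monomial ord p = m"
      using lin one by (intro leading_monomial_eqI) (simp_all add: order_on_defs in_keys_iff)
    with one show ?thesis by blast
  qed
  have comp: "compatible_order TYPE('k) L ord"
    unfolding compatible_order_def
  proof (intro conjI ballI impI mono)
    fix \<alpha> \<beta> assume "\<alpha> \<in> L" "\<beta> \<in> L" "incomparable \<alpha> \<beta>"
    then have "binomial_product L (var_monomial \<alpha> + var_monomial \<beta> + 0) (lattice_binomial \<alpha> \<beta> * (1 :: ('a set, 'k) mpoly))"
      by (intro binomial_product.intros)
    from lead[OF this] show "initial_term ord (lattice_binomial \<alpha> \<beta> :: ('a set, 'k) mpoly) = mvar \<alpha> * mvar \<beta>"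
      by (simp add: initial_term_def mvar_mult_mvar)
  qed
  have "m \<in> leading_monomial ord ` ((lattice_algebra L :: ('a set, 'k) mpoly set) - {0})"
    if "m \<in> incomparable_monomials L" for m
  proof -
    obtain p :: "('a set, 'k) mpoly" where p: "binomial_product L m p"
      using \<open>m \<in> incomparable_monomials L\<close> incomparable_monomials_iff_binomial_product by blast
    then have "p \<noteq> 0"
      using lead by fastforce
    with p show ?thesis
      using lead[OF p] binomial_product_in_algebra[OF p] by blast
  qed
  moreover have "leading_monomial ord f \<in> incomparable_monomials L"
    if "f \<in> lattice_algebra L" "f \<noteq> 0" for f :: "('a set, 'k) mpoly"
    using that lin refines by (rule leading_monomial_in_incomparable_monomials)
  ultimately have "leading_monomial ord ` ((lattice_algebra L :: ('a set, 'k) mpoly set) - {0}) = incomparable_monomials L"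
    by blast
  with comp show ?thesis
    using khovanskii_basis_iff_leading_monomials[OF Int_closed Un_closed comp] by blast
qed

end


section \<open>The order of a generalized snake poset\<close>

abbreviation snake_le :: "snake_letter list \<Rightarrow> nat \<Rightarrow> nat rel" where
  "snake_le w k \<equiv> (snake_covers w k)\<^sup>*"

text \<open>
  The element that is covered by \<open>2k+4\<close>. A turn of the word attaches the new square to \<open>2k+1\<close>, a
  repeated letter to \<open>2k+2\<close>; the first letter behaves as if it were preceded by \<open>sR\<close>.
\<close>

definition snake_attach :: "snake_letter list \<Rightarrow> nat \<Rightarrow> nat" where
  "snake_attach w k =
     (if (k = 0 \<and> snake_char w 1 = sL) \<or> (k \<ge> 1 \<and> snake_char w k \<noteq> snake_char w (Suc k))
      then 2*k+1 else 2*k+2)"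

lemma snake_attach_cases: "snake_attach w k = 2*k+1 \<or> snake_attach w k = 2*k+2"
  by (simp add: snake_attach_def)

lemma snake_covers_Suc:
  "snake_covers w (Suc k) =
     snake_covers w k \<union> {(2*k+3, 2*k+5), (2*k+4, 2*k+5), (snake_attach w k, 2*k+4)}"
  by (cases "snake_char w k"; cases "snake_char w (Suc k)"; cases "k = 0")
     (simp_all add: snake_new_covers_def snake_attach_def eval_nat_numeral insert_commute)

declare snake_covers.simps(2) [simp del]

lemma snake_covers_bounded: "(x, y) \<in> snake_covers w k \<Longrightarrow> x \<le> 2*k+3 \<and> y \<le> 2*k+3"
proof (induction k)
  case 0
  then show ?case by auto
next
  case (Suc k)
  then show ?case
    using snake_attach_cases[of w k] unfolding snake_covers_Suc by auto
qed

lemma snake_le_Suc_I: "(x, y) \<in> snake_le w k \<Longrightarrow> (x, y) \<in> snake_le w (Suc k)"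
  by (rule rtrancl_mono[THEN subsetD]) (auto simp: snake_covers_Suc)

lemma double_Suc: "2 * Suc k + 1 = 2*k+3" "2 * Suc k + 2 = 2*k+4" "2 * Suc k + 3 = 2*k+5"
  by simp_all

lemma snake_top: "x \<le> 2*k+3 \<Longrightarrow> (x, 2*k+3) \<in> snake_le w k"
proof (induction k)
  case 0
  then have "x \<in> {0, 1, 2, 3}" by auto
  moreover have "(0, 3) \<in> snake_le w 0"
    by (rule rtrancl_trans[OF r_into_rtrancl[of "(0, 1)"] r_into_rtrancl[of "(1, 3)"]]) auto
  moreover have "(1, 3) \<in> snake_le w 0" "(2, 3) \<in> snake_le w 0"
    by (rule r_into_rtrancl; simp)+
  ultimately show ?case by auto
next
  case (Suc k)
  have old: "(2*k+3, 2*k+5) \<in> snake_le w (Suc k)" "(2*k+4, 2*k+5) \<in> snake_le w (Suc k)"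
    by (rule r_into_rtrancl; simp add: snake_covers_Suc)+
  consider "x \<le> 2*k+3" | "x = 2*k+4" | "x = 2*k+5"
    using Suc.prems by fastforce
  then show ?case
  proof cases
    case 1
    from rtrancl_trans[OF snake_le_Suc_I[OF Suc.IH[OF this]] old(1)] show ?thesis
      unfolding double_Suc .
  qed (use old in \<open>simp_all only: double_Suc rtrancl.rtrancl_refl\<close>)
qed

lemma snake_top_Suc: "x \<le> 2*k+5 \<Longrightarrow> (x, 2*k+5) \<in> snake_le w (Suc k)"
  using snake_top[of x "Suc k" w] unfolding double_Suc .

lemma snake_le_Suc_iff:
  "(x, y) \<in> snake_le w (Suc k) \<longleftrightarrow>
     x = y \<or> (x \<le> 2*k+3 \<and> y \<le> 2*k+3 \<and> (x, y) \<in> snake_le w k) \<or>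
     (x \<le> 2*k+3 \<and> y = 2*k+4 \<and> (x, snake_attach w k) \<in> snake_le w k) \<or>
     (x \<le> 2*k+4 \<and> y = 2*k+5)" (is "_ \<longleftrightarrow> ?R y")
proof
  assume "(x, y) \<in> snake_le w (Suc k)"
  then show "?R y"
  proof (induction rule: rtrancl_induct)
    case base
    then show ?case by simp
  next
    case (step y z)
    from step.hyps(2) consider "(y, z) \<in> snake_covers w k" | "y = 2*k+3" "z = 2*k+5"
      | "y = 2*k+4" "z = 2*k+5" | "y = snake_attach w k" "z = 2*k+4"
      by (auto simp: snake_covers_Suc)
    then show ?case
    proof cases
      case 1
      with snake_covers_bounded[OF 1] step.IH show ?thesis
        by (auto intro: rtrancl_into_rtrancl)
    next
      case 4
      with snake_attach_cases[of w k] step.IH show ?thesis by auto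
    qed (use step.IH in auto)
  qed
next
  have top: "(2*k+3, 2*k+5) \<in> snake_le w (Suc k)" "(2*k+4, 2*k+5) \<in> snake_le w (Suc k)"
    and attach: "(snake_attach w k, 2*k+4) \<in> snake_le w (Suc k)"
    by (rule r_into_rtrancl; simp add: snake_covers_Suc)+
  assume "?R y"
  then consider "x = y" | "(x, y) \<in> snake_le w k" | "y = 2*k+4" "(x, snake_attach w k) \<in> snake_le w k"
    | "x \<le> 2*k+5" "y = 2*k+5" by auto
  then show "(x, y) \<in> snake_le w (Suc k)"
  proof cases
    case 2
    then show ?thesis by (rule snake_le_Suc_I)
  next
    case 3
    with rtrancl_trans[OF snake_le_Suc_I[OF 3(2)] attach] show ?thesis by simp
  next
    case 4
    with snake_top_Suc[of x k w] show ?thesis by simp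
  qed simp
qed

lemma snake_le_0_iff:
  "(x, y) \<in> snake_le w 0 \<longleftrightarrow> x = y \<or> (x = 0 \<and> y \<in> {1, 2, 3}) \<or> (x \<in> {1, 2} \<and> y = 3)" (is "_ \<longleftrightarrow> ?R y")
proof
  assume "(x, y) \<in> snake_le w 0"
  then show "?R y"
    by (induction rule: rtrancl_induct) auto
next
  have "(0, 1) \<in> snake_le w 0" "(0, 2) \<in> snake_le w 0"
    by (rule r_into_rtrancl; simp)+
  then show "?R y \<Longrightarrow> (x, y) \<in> snake_le w 0"
    using snake_top[of x 0 w] by auto
qed

declare snake_covers.simps(1) [simp del]

lemma snake_top_maximal: "(2*k+3, y) \<in> snake_le w k \<Longrightarrow> y = 2*k+3"
  by (cases k) (auto simp: snake_le_0_iff snake_le_Suc_iff)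

lemma snake_below_coatom:
  "x \<le> 2*k+2 \<Longrightarrow> (x, 2*k+1) \<in> snake_le w k \<or> (x, 2*k+2) \<in> snake_le w k"
proof (cases k)
  case 0
  moreover assume "x \<le> 2*k+2"
  ultimately have "x \<in> {0, 1, 2}" by auto
  with 0 show ?thesis by (auto simp: snake_le_0_iff)
next
  case (Suc j)
  moreover assume "x \<le> 2*k+2"
  ultimately consider "x \<le> 2*j+3" | "x = 2*j+4" by linarith
  then show ?thesis
    unfolding Suc double_Suc using snake_top[of x j w] by cases (simp_all add: snake_le_Suc_iff)
qed

definition chain_in :: "'a rel \<Rightarrow> 'a set \<Rightarrow> bool" where
  "chain_in r S \<longleftrightarrow> (\<forall>x\<in>S. \<forall>y\<in>S. (x, y) \<in> r \<or> (y, x) \<in> r)"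

text \<open>
  An invariant of the recursion that is needed for the width: the coatom to which the next square
  is attached leaves only a chain of elements that are not below it.
\<close>

lemma snake_not_below_coatom_chain:
  "chain_in (snake_le w k) {x. x \<le> 2*k+3 \<and> (x, 2*k+1) \<notin> snake_le w k} \<and>
   chain_in (snake_le w k) {x. x \<le> 2*k+3 \<and> (x, 2*k+2) \<notin> snake_le w k}"
proof (induction k)
  case 0
  have "x \<in> {0, 1, 2, 3}" if "x \<le> 3" for x :: nat
    using that by auto
  then show ?case
    by (fastforce simp: chain_in_def snake_le_0_iff)
next
  case (Suc k)
  have "{x. x \<le> 2*k+5 \<and> (x, 2*k+3) \<notin> snake_le w (Suc k)} \<subseteq> {2*k+4, 2*k+5}"
  proof
    fix x assume x: "x \<in> {x. x \<le> 2*k+5 \<and> (x, 2*k+3) \<notin> snake_le w (Suc k)}"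
    then have "\<not> x \<le> 2*k+3"
      using snake_top[of x k w] by (auto simp: snake_le_Suc_iff)
    with x show "x \<in> {2*k+4, 2*k+5}" by auto
  qed
  moreover have "chain_in (snake_le w (Suc k)) {2*k+4, 2*k+5}"
    by (simp add: chain_in_def snake_le_Suc_iff)
  ultimately have "chain_in (snake_le w (Suc k)) {x. x \<le> 2*k+5 \<and> (x, 2*k+3) \<notin> snake_le w (Suc k)}"
    unfolding chain_in_def by blast
  moreover have "chain_in (snake_le w (Suc k)) {x. x \<le> 2*k+5 \<and> (x, 2*k+4) \<notin> snake_le w (Suc k)}"
  proof -
    let ?S = "{x. x \<le> 2*k+3 \<and> (x, snake_attach w k) \<notin> snake_le w k}"
    have "chain_in (snake_le w k) ?S"
      using Suc.IH snake_attach_cases[of w k] by auto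
    then have "chain_in (snake_le w (Suc k)) (insert (2*k+5) ?S)"
      using snake_le_Suc_I[of _ _ w k] snake_top_Suc[of _ k w] unfolding chain_in_def by auto
    moreover have "{x. x \<le> 2*k+5 \<and> (x, 2*k+4) \<notin> snake_le w (Suc k)} \<subseteq> insert (2*k+5) ?S"
    proof
      fix x assume x: "x \<in> {x. x \<le> 2*k+5 \<and> (x, 2*k+4) \<notin> snake_le w (Suc k)}"
      then consider "x \<le> 2*k+3" | "x = 2*k+4" | "x = 2*k+5" by fastforce
      then show "x \<in> insert (2*k+5) ?S"
        using x by cases (auto simp: snake_le_Suc_iff)
    qed
    ultimately show ?thesis
      unfolding chain_in_def by blast
  qed
  ultimately show ?case
    unfolding double_Suc by blast
qed

definition comparable_in :: "'a rel \<Rightarrow> 'a \<Rightarrow> 'a \<Rightarrow> bool" where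
  "comparable_in r x y \<longleftrightarrow> (x, y) \<in> r \<or> (y, x) \<in> r"

text \<open>
  When \<open>2k+4\<close> and \<open>2k+5\<close> are added, the latter is comparable to everything, and the former is
  comparable to all elements below the coatom it is attached to; the others form a chain.
\<close>

lemma snake_width_two:
  assumes "x \<le> 2*k+3" "y \<le> 2*k+3" "z \<le> 2*k+3"
  shows "comparable_in (snake_le w k) x y \<or> comparable_in (snake_le w k) x z \<or> comparable_in (snake_le w k) y z"
  using assms
proof (induction k)
  case 0
  then have "x \<in> {0, 1, 2, 3}" "y \<in> {0, 1, 2, 3}" "z \<in> {0, 1, 2, 3}" by auto
  then show ?case
    by (elim insertE emptyE) (simp_all add: comparable_in_def snake_le_0_iff)
next
  case (Suc k)
  let ?c = "comparable_in (snake_le w (Suc k))"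
  have mono: "comparable_in (snake_le w k) a b \<Longrightarrow> ?c a b" for a b
    using snake_le_Suc_I by (auto simp: comparable_in_def)
  have top: "?c a (2*k+5)" if "a \<le> 2*k+5" for a
    using snake_top_Suc[of a k w] that by (simp add: comparable_in_def)
  have new: "?c (2*k+4) a \<or> ?c (2*k+4) b \<or> ?c a b" if "a \<le> 2*k+3" "b \<le> 2*k+3" for a b
  proof -
    have "?c (2*k+4) u" if "(u, snake_attach w k) \<in> snake_le w k" "u \<le> 2*k+3" for u
      using that by (simp add: comparable_in_def snake_le_Suc_iff)
    moreover have "chain_in (snake_le w k) {x. x \<le> 2*k+3 \<and> (x, snake_attach w k) \<notin> snake_le w k}"
      using snake_not_below_coatom_chain[of w k] snake_attach_cases[of w k] by auto
    then have "comparable_in (snake_le w k) a b"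
      if "(a, snake_attach w k) \<notin> snake_le w k" "(b, snake_attach w k) \<notin> snake_le w k"
      using that \<open>a \<le> 2*k+3\<close> \<open>b \<le> 2*k+3\<close> unfolding chain_in_def comparable_in_def by blast
    ultimately show ?thesis
      using that mono by blast
  qed
  have sym: "?c a b \<longleftrightarrow> ?c b a" and refl: "?c a a" for a b
    by (auto simp: comparable_in_def)
  have cases: "a \<le> 2*k+3 \<or> a = 2*k+4 \<or> a = 2*k+5" if "a \<le> 2 * Suc k + 3" for a
    using that by auto
  show ?case
  proof (cases "x = 2*k+5 \<or> y = 2*k+5 \<or> z = 2*k+5")
    case True
    then show ?thesis using top Suc.prems sym by auto
  next
    case False
    then consider "x \<le> 2*k+3" "y \<le> 2*k+3" "z \<le> 2*k+3" | "x = 2*k+4" "y \<le> 2*k+3" "z \<le> 2*k+3"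
      | "x \<le> 2*k+3" "y = 2*k+4" "z \<le> 2*k+3" | "x \<le> 2*k+3" "y \<le> 2*k+3" "z = 2*k+4"
      | "x = y" | "x = z" | "y = z"
      using cases[OF Suc.prems(1)] cases[OF Suc.prems(2)] cases[OF Suc.prems(3)] by metis
    then show ?thesis
    proof cases
      case 1
      then show ?thesis using Suc.IH mono by blast
    next
      case 2
      then show ?thesis using new[of y z] by simp
    next
      case 3
      then show ?thesis using new[of x z] sym by blast
    next
      case 4
      then show ?thesis using new[of x y] sym by blast
    qed (use refl in blast)+
  qed
qed

lemma generalized_snake_width_two:
  assumes "is_generalized_snake L (relation_of (\<subseteq>) L)"
    and "\<alpha> \<in> L" "\<beta> \<in> L" "\<gamma> \<in> L" "incomparable \<alpha> \<beta>" "incomparable \<alpha> \<gamma>"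
  shows "\<not> incomparable \<beta> \<gamma>"
proof
  assume "incomparable \<beta> \<gamma>"
  obtain w f where bij: "bij_betw f L (snake_carrier w)"
    and iso: "\<And>X Y. X \<in> L \<Longrightarrow> Y \<in> L \<Longrightarrow> (X, Y) \<in> relation_of (\<subseteq>) L \<longleftrightarrow> (f X, f Y) \<in> snake_order w"
    using assms(1) unfolding is_generalized_snake_def poset_iso_def by blast
  have bound: "f X \<le> 2 * length w + 3" if "X \<in> L" for X
    using bij_betw_apply[OF bij that] by (simp add: snake_carrier_def)
  have le: "(f X, f Y) \<in> snake_le w (length w) \<longleftrightarrow> X \<subseteq> Y" if "X \<in> L" "Y \<in> L" for X Y
    using iso[OF that] that bij_betw_apply[OF bij that(1)] bij_betw_apply[OF bij that(2)]
    by (simp add: relation_of_def snake_order_def)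
  show False
    using snake_width_two[OF bound[OF assms(2)] bound[OF assms(3)] bound[OF assms(4)], of w]
      assms(2-) \<open>incomparable \<beta> \<gamma>\<close> le
    by (auto simp: comparable_in_def incomparable_def)
qed

lemma snake_attach_append:
  assumes "Suc k \<le> length w"
  shows "snake_attach (w @ [a]) k = snake_attach w k"
proof -
  have "snake_char (w @ [a]) i = snake_char w i" if "i \<le> length w" for i
  proof -
    have "i - 1 < length w"
      using assms that by linarith
    then show ?thesis by (simp add: snake_char_def nth_append)
  qed
  from this[of 1] this[of k] this[of "Suc k"] show ?thesis
    using assms by (simp add: snake_attach_def)
qed

lemma snake_covers_append: "k \<le> length w \<Longrightarrow> snake_covers (w @ [a]) k = snake_covers w k"
proof (induction k)
  case 0
  show ?case by (simp only: snake_covers.simps(1))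
next
  case (Suc k)
  then show ?case
    by (simp add: snake_covers_Suc snake_attach_append)
qed

lemma ex_snake_attach:
  assumes "c = 2 * length w + 1 \<or> c = 2 * length w + 2"
  shows "\<exists>a. snake_attach (w @ [a]) (length w) = c"
proof -
  have "\<exists>a b. snake_attach (w @ [a]) (length w) = 2 * length w + 1 \<and>
      snake_attach (w @ [b]) (length w) = 2 * length w + 2"
  proof (cases "w = []")
    case True
    then show ?thesis
      by (intro exI[of _ sL] exI[of _ sR]) (simp add: snake_attach_def snake_char_def)
  next
    case False
    define a where "a = (if last w = sL then sR else sL)"
    have "w ! (length w - Suc 0) = last w"
      using False by (simp add: last_conv_nth)
    then show ?thesis
      using False
      by (intro exI[of _ a] exI[of _ "last w"])
         (simp add: snake_attach_def snake_char_def nth_append a_def Suc_le_eq)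
  qed
  with assms show ?thesis by auto
qed


section \<open>Forbidden subposets\<close>

lemma poset_iso_embedding:
  assumes "poset_iso B (Restr r B) Q q"
  shows "\<exists>g. g ` Q = B \<and> (\<forall>i\<in>Q. \<forall>j\<in>Q. (g i, g j) \<in> r \<longleftrightarrow> (i, j) \<in> q)"
proof -
  from assms obtain f where bij: "bij_betw f B Q"
    and iso: "\<And>x y. x \<in> B \<Longrightarrow> y \<in> B \<Longrightarrow> (x, y) \<in> r \<longleftrightarrow> (f x, f y) \<in> q"
    unfolding poset_iso_def by auto
  let ?g = "inv_into B f"
  have g: "?g i \<in> B" "f (?g i) = i" if "i \<in> Q" for i
    using bij_betw_apply[OF bij_betw_inv_into[OF bij] that] bij_betw_inv_into_right[OF bij that] .
  have "?g ` Q = B"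
    using bij_betw_imp_surj_on[OF bij_betw_inv_into[OF bij]] .
  moreover have "(?g i, ?g j) \<in> r \<longleftrightarrow> (i, j) \<in> q" if "i \<in> Q" "j \<in> Q" for i j
    using iso[OF g(1)[OF that(1)] g(1)[OF that(2)]] g(2) that by simp
  ultimately show ?thesis by blast
qed

lemma not_free_cases:
  assumes "\<not> free_2p2_1p1p1 P r"
  obtains (two_chains) a b c d where "{a, b, c, d} \<subseteq> P" "(a, b) \<in> r" "(c, d) \<in> r"
      "(b, a) \<notin> r" "(d, c) \<notin> r" "(a, d) \<notin> r" "(c, b) \<notin> r"
    | (antichain) a b c where "{a, b, c} \<subseteq> P" "(a, b) \<notin> r" "(b, a) \<notin> r" "(a, c) \<notin> r"
      "(c, a) \<notin> r" "(b, c) \<notin> r" "(c, b) \<notin> r"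
proof -
  from assms consider
      (1) B where "B \<subseteq> P" "poset_iso B (Restr r B) {0, 1, 2, 3} two_plus_two"
    | (2) B where "B \<subseteq> P" "poset_iso B (Restr r B) {0, 1, 2} one_plus_one_plus_one"
    unfolding free_2p2_1p1p1_def poset_free_def by blast
  then show ?thesis
  proof cases
    case 1
    from poset_iso_embedding[OF 1(2)] obtain g :: "nat \<Rightarrow> 'a" where g: "g ` {0, 1, 2, 3} = B"
      "\<forall>i\<in>{0, 1, 2, 3}. \<forall>j\<in>{0, 1, 2, 3}. (g i, g j) \<in> r \<longleftrightarrow> (i, j) \<in> two_plus_two"
      by (elim exE conjE)
    have "{g 0, g 1, g 2, g 3} \<subseteq> P"
      using g(1) 1(1) by auto
    moreover have "(g i, g j) \<in> r \<longleftrightarrow> (i, j) \<in> two_plus_two"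
      if "i \<in> {0, 1, 2, 3}" "j \<in> {0, 1, 2, 3}" for i j
      using g(2) that by blast
    ultimately show ?thesis
      by (intro two_chains[of "g 0" "g 1" "g 2" "g 3"]) (simp_all add: two_plus_two_def Id_on_iff)
  next
    case 2
    from poset_iso_embedding[OF 2(2)] obtain g :: "nat \<Rightarrow> 'a" where g: "g ` {0, 1, 2} = B"
      "\<forall>i\<in>{0, 1, 2}. \<forall>j\<in>{0, 1, 2}. (g i, g j) \<in> r \<longleftrightarrow> (i, j) \<in> one_plus_one_plus_one"
      by (elim exE conjE)
    have "{g 0, g 1, g 2} \<subseteq> P"
      using g(1) 2(1) by auto
    moreover have "(g i, g j) \<in> r \<longleftrightarrow> (i, j) \<in> one_plus_one_plus_one"
      if "i \<in> {0, 1, 2}" "j \<in> {0, 1, 2}" for i j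
      using g(2) that by blast
    ultimately show ?thesis
      by (intro antichain[of "g 0" "g 1" "g 2"]) (simp_all add: one_plus_one_plus_one_def Id_on_iff)
  qed
qed

text \<open>
  The incomparability of two chains \<open>a < b\<close> and \<open>c < d\<close> follows from \<open>\<not> a \<le> d\<close> and \<open>\<not> c \<le> b\<close>; the remaining
  relations are excluded by transitivity and antisymmetry.
\<close>

definition no_two_chains :: "'a set \<Rightarrow> 'a rel \<Rightarrow> bool" where
  "no_two_chains P r \<longleftrightarrow> (\<forall>a\<in>P. \<forall>b\<in>P. \<forall>c\<in>P. \<forall>d\<in>P.
     (a, b) \<in> r \<longrightarrow> a \<noteq> b \<longrightarrow> (c, d) \<in> r \<longrightarrow> c \<noteq> d \<longrightarrow> (a, d) \<in> r \<or> (c, b) \<in> r)"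

definition no_antichain :: "'a set \<Rightarrow> 'a rel \<Rightarrow> bool" where
  "no_antichain P r \<longleftrightarrow> (\<forall>a\<in>P. \<forall>b\<in>P. \<forall>c\<in>P.
     comparable_in r a b \<or> comparable_in r a c \<or> comparable_in r b c)"

lemma free_imp_no_two_chains:
  assumes po: "partial_order_on P r" and "free_2p2_1p1p1 P r"
  shows "no_two_chains P r"
proof (rule ccontr)
  assume "\<not> no_two_chains P r"
  then obtain a b c d where in_P: "a \<in> P" "b \<in> P" "c \<in> P" "d \<in> P"
    and ab: "(a, b) \<in> r" "a \<noteq> b" and cd: "(c, d) \<in> r" "c \<noteq> d" and not: "(a, d) \<notin> r" "(c, b) \<notin> r"
    unfolding no_two_chains_def by blast
  have trans: "(x, y) \<in> r \<Longrightarrow> (y, z) \<in> r \<Longrightarrow> (x, z) \<in> r" for x y z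
    using partial_order_onD(2)[OF po] by (rule transD)
  have anti: "(x, y) \<in> r \<Longrightarrow> (y, x) \<in> r \<Longrightarrow> x = y" for x y
    using partial_order_onD(3)[OF po] by (rule antisymD)
  have refl: "(x, x) \<in> r" if "x \<in> P" for x
    using partial_order_onD(1)[OF po] that by (auto simp: refl_on_def)
  have "(b, a) \<notin> r" "(d, c) \<notin> r"
    using ab cd anti[of a b] anti[of c d] by blast+
  moreover have "(a, c) \<notin> r" "(b, d) \<notin> r"
    using not(1) ab cd trans[of a c d] trans[of a b d] by blast+
  moreover have "(c, a) \<notin> r" "(d, b) \<notin> r"
    using not(2) ab cd trans[of c a b] trans[of c d b] by blast+
  moreover have "(d, a) \<notin> r" "(b, c) \<notin> r"
    using calculation ab cd trans[of c d a] trans[of a b c] by blast+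
  ultimately have incomp: "(b, a) \<notin> r" "(d, c) \<notin> r" "(a, c) \<notin> r" "(c, a) \<notin> r"
    "(d, a) \<notin> r" "(b, d) \<notin> r" "(d, b) \<notin> r" "(b, c) \<notin> r" by simp_all
  have distinct: "a \<noteq> c" "a \<noteq> d" "b \<noteq> c" "b \<noteq> d"
    using incomp refl in_P by auto
  define f :: "'a \<Rightarrow> nat" where "f x = (if x = a then 0 else if x = b then 1 else if x = c then 2 else 3)" for x
  have f: "f a = 0" "f b = 1" "f c = 2" "f d = 3"
    using ab(2) cd(2) distinct by (auto simp: f_def)
  have "bij_betw f {a, b, c, d} {0, 1, 2, 3}"
    by (rule bij_betw_imageI) (auto simp: f inj_on_def)
  moreover have "\<forall>x\<in>{a, b, c, d}. \<forall>y\<in>{a, b, c, d}.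
      (x, y) \<in> Restr r {a, b, c, d} \<longleftrightarrow> (f x, f y) \<in> two_plus_two"
    using f incomp not ab cd refl in_P distinct distinct[symmetric] ab(2)[symmetric] cd(2)[symmetric]
    by (simp add: two_plus_two_def Id_on_iff)
  ultimately have "poset_iso {a, b, c, d} (Restr r {a, b, c, d}) {0, 1, 2, 3} two_plus_two"
    unfolding poset_iso_def by blast
  moreover have "{a, b, c, d} \<subseteq> P"
    using in_P by simp
  ultimately show False
    using assms(2) unfolding free_2p2_1p1p1_def poset_free_def by blast
qed

lemma free_imp_no_antichain:
  assumes po: "partial_order_on P r" and "free_2p2_1p1p1 P r"
  shows "no_antichain P r"
proof (rule ccontr)
  assume "\<not> no_antichain P r"
  then obtain a b c where in_P: "a \<in> P" "b \<in> P" "c \<in> P"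
    and incomp: "(a, b) \<notin> r" "(b, a) \<notin> r" "(a, c) \<notin> r" "(c, a) \<notin> r" "(b, c) \<notin> r" "(c, b) \<notin> r"
    unfolding no_antichain_def comparable_in_def by blast
  have refl: "(x, x) \<in> r" if "x \<in> P" for x
    using partial_order_onD(1)[OF po] that by (auto simp: refl_on_def)
  have distinct: "a \<noteq> b" "a \<noteq> c" "b \<noteq> c"
    using incomp refl in_P by auto
  define f :: "'a \<Rightarrow> nat" where "f x = (if x = a then 0 else if x = b then 1 else 2)" for x
  have f: "f a = 0" "f b = 1" "f c = 2"
    using distinct by (auto simp: f_def)
  have "bij_betw f {a, b, c} {0, 1, 2}"
    by (rule bij_betw_imageI) (auto simp: f inj_on_def)
  moreover have "\<forall>x\<in>{a, b, c}. \<forall>y\<in>{a, b, c}.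
      (x, y) \<in> Restr r {a, b, c} \<longleftrightarrow> (f x, f y) \<in> one_plus_one_plus_one"
    using f incomp refl in_P distinct distinct[symmetric]
    by (simp add: one_plus_one_plus_one_def Id_on_iff)
  ultimately have "poset_iso {a, b, c} (Restr r {a, b, c}) {0, 1, 2} one_plus_one_plus_one"
    unfolding poset_iso_def by blast
  moreover have "{a, b, c} \<subseteq> P"
    using in_P by simp
  ultimately show False
    using assms(2) unfolding free_2p2_1p1p1_def poset_free_def by blast
qed


section \<open>Removing a maximal element\<close>

definition maximal_in :: "'a set \<Rightarrow> 'a rel \<Rightarrow> 'a \<Rightarrow> bool" where
  "maximal_in P r m \<longleftrightarrow> m \<in> P \<and> (\<forall>x. (m, x) \<in> r \<longrightarrow> x = m)"

lemma ex_maximal_above: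
  assumes "finite P" "partial_order_on P r" "x \<in> P"
  shows "\<exists>m. maximal_in P r m \<and> (x, m) \<in> r"
proof -
  have sub: "r \<subseteq> P \<times> P" and refl: "(x, x) \<in> r" and trans: "trans r"
    using partial_order_onD[OF assms(2)] assms(3) by (auto simp: refl_on_def)
  have "finite r"
    using assms(1) sub finite_subset by blast
  then have "wf (r\<inverse> - Id)"
    using assms(2) by (intro partial_order_on_well_order_on[of _ P]) simp_all
  moreover have "x \<in> {y. (x, y) \<in> r}"
    using refl by simp
  ultimately obtain m where m: "(x, m) \<in> r" and max: "\<And>y. (y, m) \<in> r\<inverse> - Id \<Longrightarrow> y \<notin> {y. (x, y) \<in> r}"
    by (rule wfE_min) blast
  have "y = m" if "(m, y) \<in> r" for y
    using max[of y] that transD[OF trans m that] by auto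
  then show ?thesis
    using m sub unfolding maximal_in_def by blast
qed

text \<open>
  The poset has exactly two maximal elements: with a single one it would be an ordinal sum, and
  three would form an antichain. If neither of the two were above all other elements, the
  failures would give two chains as in \<open>(2+2)\<close>.
\<close>

lemma ex_dominating_maximal:
  assumes fin: "finite P" and po: "partial_order_on P r" and card: "card P \<ge> 2"
    and irr: "ordinal_irreducible P r" and chains: "no_two_chains P r" and anti: "no_antichain P r"
  shows "\<exists>m m'. maximal_in P r m \<and> maximal_in P r m' \<and> m \<noteq> m' \<and> (\<forall>x\<in>P. x \<noteq> m' \<longrightarrow> (x, m) \<in> r)"
proof -
  have sub: "r \<subseteq> P \<times> P"
    using partial_order_onD[OF po] by simp
  have "P \<noteq> {}"
    using card by auto
  then obtain x1 where "x1 \<in> P" by blast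
  from ex_maximal_above[OF fin po this] obtain m1 where m1: "maximal_in P r m1" by blast
  have "\<exists>x\<in>P. (x, m1) \<notin> r"
  proof (rule ccontr)
    assume "\<not> ?thesis"
    then have above: "(x, m1) \<in> r" if "x \<in> P" for x using that by blast
    have "r = ordinal_sum (P - {m1}) (Restr r (P - {m1})) {m1} (Restr r {m1})"
      using sub above m1 unfolding ordinal_sum_def maximal_in_def by blast
    moreover have "P \<noteq> {m1}"
      using card by auto
    then have "P - {m1} \<noteq> {}"
      using \<open>P \<noteq> {}\<close> by blast
    moreover have "(P - {m1}) \<inter> {m1} = {}" "(P - {m1}) \<union> {m1} = P"
      using m1 by (auto simp: maximal_in_def)
    ultimately show False
      using irr unfolding ordinal_irreducible_def by (metis insert_not_empty)
  qed
  then obtain x0 where x0: "x0 \<in> P" "(x0, m1) \<notin> r" by blast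
  from ex_maximal_above[OF fin po x0(1)]
  obtain m2 where m2: "maximal_in P r m2" "(x0, m2) \<in> r" by blast
  have "m1 \<noteq> m2"
    using x0 m2 by blast
  have covered: "(x, m1) \<in> r \<or> (x, m2) \<in> r" if "x \<in> P" for x
  proof -
    from ex_maximal_above[OF fin po that] obtain y where y: "maximal_in P r y" "(x, y) \<in> r"
      by blast
    have "comparable_in r m1 m2 \<or> comparable_in r m1 y \<or> comparable_in r m2 y"
      using anti m1 m2(1) y(1) unfolding no_antichain_def maximal_in_def by blast
    then have "y = m1 \<or> y = m2"
      using m1 m2(1) y(1) \<open>m1 \<noteq> m2\<close> unfolding comparable_in_def maximal_in_def by metis
    with y show ?thesis by blast
  qed
  show ?thesis
  proof (cases "\<forall>x\<in>P. x \<noteq> m2 \<longrightarrow> (x, m1) \<in> r")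
    case True
    with m1 m2(1) \<open>m1 \<noteq> m2\<close> show ?thesis by blast
  next
    case False
    then obtain x where x: "x \<in> P" "x \<noteq> m2" "(x, m1) \<notin> r" by blast
    then have "(x, m2) \<in> r"
      using covered by blast
    have "(y, m2) \<in> r" if y: "y \<in> P" "y \<noteq> m1" for y
    proof (rule ccontr)
      assume "(y, m2) \<notin> r"
      then have "(y, m1) \<in> r"
        using covered y by blast
      with \<open>(x, m2) \<in> r\<close> x y \<open>(y, m2) \<notin> r\<close> show False
        using chains m1 m2(1) unfolding no_two_chains_def maximal_in_def by blast
    qed
    with m1 m2(1) \<open>m1 \<noteq> m2\<close> show ?thesis by blast
  qed
qed

text \<open>
  In a decomposition of the smaller poset \<open>m'\<close> belongs to the upper part, because it is maximal.
  Then \<open>m\<close> is above the whole lower part and can be added to the upper part, which decomposes \<open>P\<close>.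
\<close>

lemma ordinal_irreducible_remove:
  assumes po: "partial_order_on P r" and irr: "ordinal_irreducible P r"
    and m: "maximal_in P r m" "maximal_in P r m'" "m \<noteq> m'" and dom: "\<forall>x\<in>P. x \<noteq> m' \<longrightarrow> (x, m) \<in> r"
  shows "ordinal_irreducible (P - {m}) (Restr r (P - {m}))"
  unfolding ordinal_irreducible_def
proof
  assume "\<exists>B C. B \<noteq> {} \<and> C \<noteq> {} \<and> B \<inter> C = {} \<and> B \<union> C = P - {m} \<and>
    Restr r (P - {m}) = ordinal_sum B (Restr (Restr r (P - {m})) B) C (Restr (Restr r (P - {m})) C)"
  then obtain B C where BC: "B \<noteq> {}" "C \<noteq> {}" "B \<inter> C = {}" "B \<union> C = P - {m}"
    and sum: "Restr r (P - {m}) = ordinal_sum B (Restr (Restr r (P - {m})) B) C (Restr (Restr r (P - {m})) C)"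
    by (elim exE conjE)
  have sub: "r \<subseteq> P \<times> P"
    using partial_order_onD[OF po] by simp
  have mem: "(x, y) \<in> r \<and> x \<in> P - {m} \<and> y \<in> P - {m} \<longleftrightarrow>
      (x, y) \<in> r \<and> (x \<in> B \<and> y \<in> B \<or> x \<in> C \<and> y \<in> C) \<or> x \<in> B \<and> y \<in> C" for x y
  proof -
    have "B \<subseteq> P - {m}" "C \<subseteq> P - {m}"
      unfolding BC(4)[symmetric] by simp_all
    with arg_cong[OF sum, of "\<lambda>S. (x, y) \<in> S"] show ?thesis
      unfolding ordinal_sum_def by blast
  qed
  have below: "(b, c) \<in> r" if "b \<in> B" "c \<in> C" for b c
    using mem[of b c] that by simp
  have not_above: "(c, b) \<notin> r" if "b \<in> B" "c \<in> C" for b c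
  proof
    assume "(c, b) \<in> r"
    moreover have "c \<in> P - {m}" "b \<in> P - {m}"
      unfolding BC(4)[symmetric] using that by simp_all
    moreover have "c \<notin> B" "b \<notin> C"
      using that BC(3) by auto
    ultimately show False
      using mem[of c b] by simp
  qed
  obtain c where c: "c \<in> C"
    using BC(2) by blast
  have "m' \<notin> B"
  proof
    assume "m' \<in> B"
    then have "c = m'"
      using below[OF _ c] m(2) by (simp add: maximal_in_def)
    with \<open>m' \<in> B\<close> c BC(3) show False by blast
  qed
  have subs: "B \<subseteq> P - {m}" "C \<subseteq> P - {m}"
    unfolding BC(4)[symmetric] by simp_all
  have top: "(b, m) \<in> r" if "b \<in> B" for b
  proof -
    have "b \<in> P" "b \<noteq> m'"
      using that subs(1) \<open>m' \<notin> B\<close> by auto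
    with dom show ?thesis by simp
  qed
  have cover: "x \<in> B \<or> x \<in> C \<or> x = m" if "x \<in> P" for x
  proof -
    have "x \<in> B \<union> C \<or> x = m"
      unfolding BC(4) using that by simp
    then show ?thesis by simp
  qed
  have above_m: "x = m" if "(m, x) \<in> r" for x
    using m(1) that by (simp add: maximal_in_def)
  have "(x, y) \<in> r \<longleftrightarrow> (x, y) \<in> ordinal_sum B (Restr r B) (insert m C) (Restr r (insert m C))" for x y
  proof
    assume xy: "(x, y) \<in> r"
    then have "x \<in> P" "y \<in> P"
      using sub by auto
    then show "(x, y) \<in> ordinal_sum B (Restr r B) (insert m C) (Restr r (insert m C))"
      using xy cover[of x] cover[of y] not_above[of y x] above_m[of y] subs(1)
      by (auto simp: ordinal_sum_def)
  next
    assume "(x, y) \<in> ordinal_sum B (Restr r B) (insert m C) (Restr r (insert m C))"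
    then show "(x, y) \<in> r"
      using below[of x y] top[of x] by (auto simp: ordinal_sum_def)
  qed
  then have eq: "r = ordinal_sum B (Restr r B) (insert m C) (Restr r (insert m C))"
    by (intro set_eqI) (simp only: split_paired_all)
  have disjoint: "B \<inter> insert m C = {}"
    using BC(3) subs(1) by blast
  have union: "B \<union> insert m C = P"
    using BC(4) m(1) by (auto simp: maximal_in_def)
  show False
    by (rule notE[OF irr[unfolded ordinal_irreducible_def]],
        rule exI[of _ B], rule exI[of _ "insert m C"],
        intro conjI BC(1) insert_not_empty disjoint union) (rule eq)
qed

text \<open>
  An ideal that contains \<open>m\<close> contains all elements except possibly \<open>m'\<close>.
\<close>

lemma poset_ideals_remove:
  assumes po: "partial_order_on P r"
    and m: "maximal_in P r m" "maximal_in P r m'" "m \<noteq> m'" and dom: "\<forall>x\<in>P. x \<noteq> m' \<longrightarrow> (x, m) \<in> r"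
  shows "poset_ideals P r = poset_ideals (P - {m}) (Restr r (P - {m})) \<union> {P - {m'}} \<union> {P}"
proof
  show "poset_ideals P r \<subseteq> poset_ideals (P - {m}) (Restr r (P - {m})) \<union> {P - {m'}} \<union> {P}"
  proof
    fix X assume X: "X \<in> poset_ideals P r"
    then have sub: "X \<subseteq> P" and down: "\<And>a b. a \<in> X \<Longrightarrow> b \<in> P \<Longrightarrow> (b, a) \<in> r \<Longrightarrow> b \<in> X"
      by (auto simp: poset_ideals_def)
    show "X \<in> poset_ideals (P - {m}) (Restr r (P - {m})) \<union> {P - {m'}} \<union> {P}"
    proof (cases "m \<in> X")
      case True
      then have "P - {m'} \<subseteq> X"
        using down dom by blast
      with sub show ?thesis by blast
    next
      case False
      then show ?thesis
        using sub down unfolding poset_ideals_def by blast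
    qed
  qed
  have "P - {m'} \<in> poset_ideals P r"
    using m(2) unfolding poset_ideals_def maximal_in_def by blast
  moreover have "P \<in> poset_ideals P r"
    unfolding poset_ideals_def by blast
  moreover have "X \<in> poset_ideals P r" if "X \<in> poset_ideals (P - {m}) (Restr r (P - {m}))" for X
    using that m(1) unfolding poset_ideals_def maximal_in_def by blast
  ultimately show "poset_ideals (P - {m}) (Restr r (P - {m})) \<union> {P - {m'}} \<union> {P} \<subseteq> poset_ideals P r"
    by blast
qed


section \<open>Ideal lattices of irreducible free posets are snakes\<close>

definition snake_embedding ::
    "('a set \<Rightarrow> nat) \<Rightarrow> 'a set set \<Rightarrow> snake_letter list \<Rightarrow> bool" where
  "snake_embedding f L w \<longleftrightarrow> bij_betw f L {0..2 * length w + 3} \<and>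
     (\<forall>X\<in>L. \<forall>Y\<in>L. X \<subseteq> Y \<longleftrightarrow> (f X, f Y) \<in> snake_le w (length w))"

lemma snake_embedding_imp_generalized_snake:
  assumes "snake_embedding f L w"
  shows "is_generalized_snake L (relation_of (\<subseteq>) L)"
  unfolding is_generalized_snake_def poset_iso_def
proof (intro exI conjI ballI)
  show bij: "bij_betw f L (snake_carrier w)"
    using assms by (simp add: snake_embedding_def snake_carrier_def)
  fix X Y assume XY: "X \<in> L" "Y \<in> L"
  have "f X \<in> snake_carrier w" "f Y \<in> snake_carrier w"
    using bij_betw_apply[OF bij XY(1)] bij_betw_apply[OF bij XY(2)] .
  moreover have "X \<subseteq> Y \<longleftrightarrow> (f X, f Y) \<in> snake_le w (length w)"
    using assms XY by (simp add: snake_embedding_def)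
  ultimately show "(X, Y) \<in> relation_of (\<subseteq>) L \<longleftrightarrow> (f X, f Y) \<in> snake_order w"
    using XY by (simp add: relation_of_def snake_order_def)
qed

text \<open>
  The coatom \<open>X0\<close> corresponds to one of the elements \<open>2k+1\<close> and \<open>2k+2\<close> of the snake with top \<open>2k+3\<close>,
  and the appended letter can be chosen so that the next square is attached to that element.
\<close>

lemma snake_embedding_extend:
  assumes emb: "snake_embedding f L w" and P: "P \<in> L" "\<And>Y. Y \<in> L \<Longrightarrow> Y \<subseteq> P"
    and X0: "X0 \<in> L" "X0 \<noteq> P" "\<And>Y. Y \<in> L \<Longrightarrow> X0 \<subseteq> Y \<Longrightarrow> Y = X0 \<or> Y = P"
    and m: "m \<notin> P"
  shows "\<exists>f a. snake_embedding f (L \<union> {insert m X0} \<union> {insert m P}) (w @ [a])"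
proof -
  let ?n = "length w"
  have bij: "bij_betw f L {0..2 * ?n + 3}"
    and iso: "\<And>X Y. X \<in> L \<Longrightarrow> Y \<in> L \<Longrightarrow> (f X, f Y) \<in> snake_le w ?n \<longleftrightarrow> X \<subseteq> Y"
    using emb by (simp_all add: snake_embedding_def)
  have bound: "f X \<le> 2 * ?n + 3" if "X \<in> L" for X
    using bij_betw_apply[OF bij that] by simp
  have inj: "X = Y" if "X \<in> L" "Y \<in> L" "f X = f Y" for X Y
    using bij_betw_imp_inj_on[OF bij] that by (simp add: inj_on_def)
  have onto: "\<exists>X\<in>L. f X = i" if "i \<le> 2 * ?n + 3" for i
  proof -
    have "i \<in> f ` L"
      using bij_betw_imp_surj_on[OF bij] that by simp
    then show ?thesis by auto
  qed
  have fP: "f P = 2 * ?n + 3"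
  proof -
    obtain X where X: "X \<in> L" "f X = 2 * ?n + 3"
      using onto[of "2 * ?n + 3"] by auto
    have "(2 * ?n + 3, f P) \<in> snake_le w ?n"
      using iso[OF X(1) P(1)] P(2)[OF X(1)] X(2) by simp
    then show ?thesis by (rule snake_top_maximal)
  qed
  have fX0: "f X0 \<le> 2 * ?n + 2"
    using bound[OF X0(1)] inj[OF X0(1) P(1)] fP X0(2) by fastforce
  obtain d where d: "d = 2 * ?n + 1 \<or> d = 2 * ?n + 2" "(f X0, d) \<in> snake_le w ?n"
    using snake_below_coatom[OF fX0, of w] by blast
  then obtain Y where Y: "Y \<in> L" "f Y = d"
    using onto[of d] by auto
  have "X0 \<subseteq> Y"
    using iso[OF X0(1) Y(1)] d(2) Y(2) by simp
  moreover have "Y \<noteq> P"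
    using Y(2) d(1) fP by auto
  ultimately have "f X0 = d"
    using X0(3)[OF Y(1)] Y(2) by blast
  with d(1) obtain a where a: "snake_attach (w @ [a]) ?n = f X0"
    using ex_snake_attach[of "f X0" w] by blast
  have covers: "snake_covers (w @ [a]) ?n = snake_covers w ?n"
    by (rule snake_covers_append) simp
  have le: "(x, y) \<in> snake_le (w @ [a]) (Suc ?n) \<longleftrightarrow>
     x = y \<or> (x \<le> 2 * ?n + 3 \<and> y \<le> 2 * ?n + 3 \<and> (x, y) \<in> snake_le w ?n) \<or>
     (x \<le> 2 * ?n + 3 \<and> y = 2 * ?n + 4 \<and> (x, f X0) \<in> snake_le w ?n) \<or>
     (x \<le> 2 * ?n + 4 \<and> y = 2 * ?n + 5)" for x y
    unfolding snake_le_Suc_iff a covers by (rule refl)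
  define g where "g X = (if X = insert m P then 2 * ?n + 5 else if X = insert m X0 then 2 * ?n + 4 else f X)" for X
  have not_m: "m \<notin> X" if "X \<in> L" for X
    using P(2)[OF that] m by blast
  have ne: "insert m X0 \<noteq> insert m P"
    using insert_ident[OF not_m[OF X0(1)] m] X0(2) by simp
  have notin: "insert m X0 \<notin> L" "insert m P \<notin> L"
    using not_m by blast+
  have g_new: "g (insert m P) = 2 * ?n + 5" "g (insert m X0) = 2 * ?n + 4"
    using ne by (simp_all add: g_def)
  have g_old: "g X = f X" if "X \<in> L" for X
    using that notin by (auto simp: g_def)
  have "bij_betw g L {0..2 * ?n + 3}"
    using bij_betw_cong[of L g f, OF g_old] bij by simp
  then have "bij_betw g (L \<union> {insert m X0}) ({0..2 * ?n + 3} \<union> {g (insert m X0)})"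
    by (rule notIn_Un_bij_betw[rotated 2]) (use notin g_new in auto)
  then have "bij_betw g (L \<union> {insert m X0} \<union> {insert m P})
      ({0..2 * ?n + 3} \<union> {g (insert m X0)} \<union> {g (insert m P)})"
    by (rule notIn_Un_bij_betw[rotated 2]) (use notin g_new ne in auto)
  moreover have "{0..2 * ?n + 3} \<union> {g (insert m X0)} \<union> {g (insert m P)} = {0..2 * length (w @ [a]) + 3}"
    unfolding g_new by auto
  ultimately have bij_g: "bij_betw g (L \<union> {insert m X0} \<union> {insert m P}) {0..2 * length (w @ [a]) + 3}"
    by simp
  have old_new: "X \<subseteq> insert m X0 \<longleftrightarrow> X \<subseteq> X0" "X \<subseteq> insert m P" "\<not> insert m X0 \<subseteq> X" "\<not> insert m P \<subseteq> X"
    if "X \<in> L" for X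
    using not_m[OF that] P(2)[OF that] by blast+
  have new_new: "insert m X0 \<subseteq> insert m P" "\<not> insert m P \<subseteq> insert m X0"
    using P(2)[OF X0(1)] ne by blast+
  have iso_g: "X \<subseteq> Y \<longleftrightarrow> (g X, g Y) \<in> snake_le (w @ [a]) (Suc ?n)"
    if mem: "X \<in> L \<union> {insert m X0} \<union> {insert m P}" "Y \<in> L \<union> {insert m X0} \<union> {insert m P}" for X Y
  proof -
    from mem show ?thesis
    proof (elim UnE singletonE)
      assume 1: "X \<in> L" "Y \<in> L"
      show ?thesis
        using iso[OF 1] inj[OF 1] bound[OF 1(1)] bound[OF 1(2)] 1 by (auto simp: le g_old)
    next
      assume 1: "X \<in> L" "Y = insert m X0"
      show ?thesis
        using iso[OF 1(1) X0(1)] bound[OF 1(1)] old_new(1)[OF 1(1)] 1 by (simp add: le g_old g_new)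
    next
      assume 1: "X \<in> L" "Y = insert m P"
      show ?thesis
        using bound[OF 1(1)] old_new(2)[OF 1(1)] 1 by (simp add: le g_old g_new)
    next
      assume 1: "X = insert m X0" "Y \<in> L"
      show ?thesis
        using bound[OF 1(2)] old_new(3)[OF 1(2)] 1 by (simp add: le g_old g_new)
    next
      assume 1: "X = insert m P" "Y \<in> L"
      show ?thesis
        using bound[OF 1(2)] old_new(4)[OF 1(2)] 1 by (simp add: le g_old g_new)
    qed (use new_new in \<open>simp_all add: le g_new\<close>)
  qed
  have "snake_embedding g (L \<union> {insert m X0} \<union> {insert m P}) (w @ [a])"
    unfolding snake_embedding_def using bij_g iso_g by simp
  then show ?thesis by blast
qed

lemma ex_snake_embedding_square:
  assumes "m \<noteq> m'"
  shows "\<exists>f. snake_embedding f {{}, {m'}, {m}, {m, m'}} []"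
proof -
  define f where "f X = (if m' \<in> X then 1 else 0) + (if m \<in> X then 2 else 0 :: nat)" for X
  have f: "f {} = 0" "f {m'} = 1" "f {m} = 2" "f {m, m'} = 3"
    using assms by (simp_all add: f_def)
  have inj: "inj_on f {{}, {m'}, {m}, {m, m'}}"
    by (simp add: inj_on_def f)
  have image: "f ` {{}, {m'}, {m}, {m, m'}} = {0..3}"
  proof -
    have "{0..3} = {0, 1, 2, 3 :: nat}" by auto
    then show ?thesis by (simp add: f)
  qed
  have iso: "\<forall>X\<in>{{}, {m'}, {m}, {m, m'}}. \<forall>Y\<in>{{}, {m'}, {m}, {m, m'}}.
      X \<subseteq> Y \<longleftrightarrow> (f X, f Y) \<in> snake_le [] 0"
    using assms by (simp add: f snake_le_0_iff)
  have "snake_embedding f {{}, {m'}, {m}, {m, m'}} []"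
    unfolding snake_embedding_def bij_betw_def list.size(3) mult_0_right add_0
    by (intro conjI inj image iso)
  then show ?thesis by blast
qed

lemma ideals_snake_embedding:
  assumes "finite P" "partial_order_on P r" "card P = n + 2" "ordinal_irreducible P r"
    "no_two_chains P r" "no_antichain P r"
  shows "\<exists>f w. snake_embedding f (poset_ideals P r) w"
  using assms
proof (induction n arbitrary: P r)
  case (0 P r)
  have "card P \<ge> 2"
    using 0(3) by simp
  from ex_dominating_maximal[OF 0(1,2) this 0(4-6)]
  obtain m m' where m: "maximal_in P r m" "maximal_in P r m'" "m \<noteq> m'"
    and dom: "\<forall>x\<in>P. x \<noteq> m' \<longrightarrow> (x, m) \<in> r"
    by (elim exE conjE)
  have "{m, m'} \<subseteq> P"
    using m by (auto simp: maximal_in_def)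
  then have P: "P = {m, m'}"
    using 0(1,3) m(3) by (intro card_subset_eq[symmetric]) simp_all
  have "P - {m} = {m'}" "P - {m'} = {m}"
    using P m(3) by auto
  moreover have "poset_ideals {m'} r' = {{}, {m'}}" for r'
    by (auto simp: poset_ideals_def)
  ultimately have "poset_ideals P r = {{}, {m'}, {m}, {m, m'}}"
    unfolding poset_ideals_remove[OF 0(2) m dom] using P by (simp add: insert_commute)
  then show ?case
    using ex_snake_embedding_square[OF m(3)] by (simp only:) blast
next
  case (Suc n P r)
  have "card P \<ge> 2"
    using Suc.prems(3) by simp
  from ex_dominating_maximal[OF Suc.prems(1,2) this Suc.prems(4-6)]
  obtain m m' where m: "maximal_in P r m" "maximal_in P r m'" "m \<noteq> m'"
    and dom: "\<forall>x\<in>P. x \<noteq> m' \<longrightarrow> (x, m) \<in> r"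
    by (elim exE conjE)
  have mP: "m \<in> P" "m' \<in> P"
    using m by (auto simp: maximal_in_def)
  let ?P = "P - {m}" and ?r = "Restr r (P - {m})"
  let ?L = "poset_ideals ?P ?r"
  have po: "partial_order_on ?P ?r"
    unfolding partial_order_on_def preorder_on_def
  proof (intro conjI)
    show "refl_on ?P ?r"
      using partial_order_onD(1)[OF Suc.prems(2)] by (simp add: refl_on_def)
    show "trans ?r"
      using partial_order_onD(2)[OF Suc.prems(2)] by (rule trans_Restr)
    show "antisym ?r"
      using partial_order_onD(3)[OF Suc.prems(2)] by (rule antisym_subset[rotated]) blast
  qed blast
  have "\<exists>f w. snake_embedding f ?L w"
  proof (rule Suc.IH)
    show "finite ?P" "partial_order_on ?P ?r"
      using Suc.prems(1) po by simp_all
    show "card ?P = n + 2"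
      using Suc.prems(1,3) mP by simp
    show "ordinal_irreducible ?P ?r"
      by (rule ordinal_irreducible_remove[OF Suc.prems(2,4) m dom])
    show "no_two_chains ?P ?r"
      using Suc.prems(5) unfolding no_two_chains_def by simp
    show "no_antichain ?P ?r"
      using Suc.prems(6) unfolding no_antichain_def comparable_in_def by simp blast
  qed
  then obtain f w where emb: "snake_embedding f ?L w" by blast
  have "\<exists>f a. snake_embedding f (?L \<union> {insert m (?P - {m'})} \<union> {insert m ?P}) (w @ [a])"
  proof (rule snake_embedding_extend[OF emb])
    show "?P \<in> ?L" "\<And>Y. Y \<in> ?L \<Longrightarrow> Y \<subseteq> ?P"
      by (auto simp: poset_ideals_def)
    show "?P - {m'} \<in> ?L"
      using m(2) by (auto simp: poset_ideals_def maximal_in_def)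
    show "?P - {m'} \<noteq> ?P"
      using mP m(3) by blast
    show "Y = ?P - {m'} \<or> Y = ?P" if "Y \<in> ?L" "?P - {m'} \<subseteq> Y" for Y
    proof -
      have "Y \<subseteq> ?P"
        using that(1) by (simp add: poset_ideals_def)
      with that(2) show ?thesis by blast
    qed
  qed simp
  moreover have "insert m (?P - {m'}) = P - {m'}" "insert m ?P = P"
    using mP m(3) by auto
  ultimately show ?case
    unfolding poset_ideals_remove[OF Suc.prems(2) m dom] by (simp only:) blast
qed


section \<open>The equivalence\<close>

lemma poset_ideals_Int: "\<alpha> \<in> poset_ideals P r \<Longrightarrow> \<beta> \<in> poset_ideals P r \<Longrightarrow> \<alpha> \<inter> \<beta> \<in> poset_ideals P r"
  by (auto simp: poset_ideals_def)

lemma poset_ideals_Un: "\<alpha> \<in> poset_ideals P r \<Longrightarrow> \<beta> \<in> poset_ideals P r \<Longrightarrow> \<alpha> \<union> \<beta> \<in> poset_ideals P r"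
  by (auto simp: poset_ideals_def)

text \<open>
  Strict convexity of the square: \<open>\<alpha> \<inter> \<beta>\<close> and \<open>\<alpha> \<union> \<beta>\<close> have the same total size as \<open>\<alpha>\<close> and \<open>\<beta>\<close>, but
  their sizes are farther apart.
\<close>

lemma square_card_decreases:
  assumes "finite P" "\<alpha> \<subseteq> P" "\<beta> \<subseteq> P" "incomparable \<alpha> \<beta>"
  defines "w \<equiv> \<lambda>\<gamma>. (card P)\<^sup>2 - (card \<gamma>)\<^sup>2"
  shows "w (\<alpha> \<inter> \<beta>) + w (\<alpha> \<union> \<beta>) < w \<alpha> + w \<beta>"
proof -
  have fin: "finite \<alpha>" "finite \<beta>"
    using assms(1-3) finite_subset by auto
  define i where "i = card (\<alpha> \<inter> \<beta>)"
  define a where "a = card (\<alpha> - \<beta>)"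
  define b where "b = card (\<beta> - \<alpha>)"
  have "\<alpha> - \<beta> \<noteq> {}" "\<beta> - \<alpha> \<noteq> {}"
    using assms(4) by (auto simp: incomparable_def)
  then have pos: "a > 0" "b > 0"
    using fin by (simp_all add: a_def b_def card_gt_0_iff)
  have card_\<alpha>: "card \<alpha> = i + a"
    unfolding i_def a_def using fin by (metis card_Int_Diff)
  have card_\<beta>: "card \<beta> = i + b"
    unfolding i_def b_def using fin by (metis card_Int_Diff Int_commute)
  have card_Un: "card (\<alpha> \<union> \<beta>) = i + a + b"
    using card_Un_Int[OF fin] card_\<alpha> card_\<beta> by (simp add: i_def)
  have le: "(card \<gamma>)\<^sup>2 \<le> (card P)\<^sup>2" if "\<gamma> \<subseteq> P" for \<gamma>
    using card_mono[OF assms(1) that] by (simp add: power_mono)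
  have "(card \<alpha>)\<^sup>2 + (card \<beta>)\<^sup>2 < (card (\<alpha> \<inter> \<beta>))\<^sup>2 + (card (\<alpha> \<union> \<beta>))\<^sup>2"
    unfolding card_\<alpha> card_\<beta> card_Un i_def[symmetric] using pos
    by (simp add: power2_eq_square algebra_simps)
  moreover have "\<alpha> \<inter> \<beta> \<subseteq> P" "\<alpha> \<union> \<beta> \<subseteq> P"
    using assms(2,3) by auto
  ultimately show ?thesis
    unfolding w_def using le[of "\<alpha> \<inter> \<beta>"] le[of "\<alpha> \<union> \<beta>"] le[OF assms(2)] le[OF assms(3)] by linarith
qed

text \<open>
  Two chains \<open>a < b\<close> and \<open>c < d\<close> give the grid above the ideal of common lower bounds of \<open>b\<close> and \<open>d\<close>.
  An antichain gives the cube above the ideal of all elements strictly below one of its members.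
\<close>

lemma khovanskii_imp_free:
  fixes P :: "'a set"
  assumes po: "partial_order_on P r"
    and comp: "compatible_order TYPE('k::field) (poset_ideals P r) ord"
    and khov: "khovanskii_basis ord (lattice_algebra (poset_ideals P r) :: ('a set, 'k) mpoly set)
      (lattice_binomials (poset_ideals P r))"
  shows "free_2p2_1p1p1 P r"
proof (rule ccontr)
  assume "\<not> free_2p2_1p1p1 P r"
  have trans: "(x, y) \<in> r \<Longrightarrow> (y, z) \<in> r \<Longrightarrow> (x, z) \<in> r" for x y z
    using partial_order_onD(2)[OF po] by (rule transD)
  have anti: "(x, y) \<in> r \<Longrightarrow> (y, x) \<in> r \<Longrightarrow> x = y" for x y
    using partial_order_onD(3)[OF po] by (rule antisymD)
  have refl: "(x, x) \<in> r" if "x \<in> P" for x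
    using partial_order_onD(1)[OF po] that by (auto simp: refl_on_def)
  define down where "down x = {y \<in> P. (y, x) \<in> r}" for x
  have down: "down x \<in> poset_ideals P r" for x
    using trans by (auto simp: down_def poset_ideals_def)
  note closed = poset_ideals_Int[of _ P r] poset_ideals_Un[of _ P r]
  from \<open>\<not> free_2p2_1p1p1 P r\<close> show False
  proof (cases rule: not_free_cases)
    case (two_chains a b c d)
    show False
    proof (rule no_khovanskii_grid[OF closed comp khov,
        of "(down b \<inter> down d) \<union> down a" "down b" "(down b \<inter> down d) \<union> down c" "down d"])
      have "a \<in> P" "b \<in> P" "c \<in> P" "d \<in> P"
        using two_chains(1) by simp_all
      note refls = refl[OF this(1)] refl[OF this(2)] refl[OF this(3)] refl[OF this(4)] this
      have "down a \<subseteq> down b" "down c \<subseteq> down d"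
        using two_chains(2,3) trans by (auto simp: down_def)
      moreover have "b \<in> down b" "d \<in> down d" "a \<in> down a" "c \<in> down c"
        using refls by (simp_all add: down_def)
      moreover have "b \<notin> down a" "b \<notin> down d" "d \<notin> down c" "d \<notin> down b" "a \<notin> down d" "c \<notin> down b"
        using two_chains trans by (auto simp: down_def)
      ultimately show "(down b \<inter> down d) \<union> down a \<subset> down b" "(down b \<inter> down d) \<union> down c \<subset> down d"
        "down b \<inter> down d \<subset> (down b \<inter> down d) \<union> down a" "down b \<inter> down d \<subset> (down b \<inter> down d) \<union> down c"
        by blast+
    qed (assumption | intro down poset_ideals_Int poset_ideals_Un)+
  next
    case (antichain a b c)
    define z where "z = (down a \<union> down b \<union> down c) - {a, b, c}"
    have P: "a \<in> P" "b \<in> P" "c \<in> P"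
      using antichain(1) by simp_all
    have distinct: "a \<noteq> b" "a \<noteq> c" "b \<noteq> c"
      using antichain P refl by auto
    have ideal: "insert x z \<in> poset_ideals P r" if "x \<in> {a, b, c}" for x
      unfolding poset_ideals_def
    proof (intro CollectI conjI ballI impI)
      show "insert x z \<subseteq> P"
        using that P by (auto simp: z_def down_def)
      fix u v assume u: "u \<in> insert x z" and v: "v \<in> P" "(v, u) \<in> r"
      have "\<exists>y. y \<in> {a, b, c} \<and> (u, y) \<in> r \<and> (u = y \<and> y = x \<or> u \<notin> {a, b, c})"
      proof (cases "u = x")
        case True
        have "x \<in> P"
          using that P by auto
        from refl[OF this] True that show ?thesis by blast
      next
        case False
        with u show ?thesis by (auto simp: z_def down_def)
      qed
      then obtain y where y: "y \<in> {a, b, c}" "(u, y) \<in> r" "u = y \<and> y = x \<or> u \<notin> {a, b, c}"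
        by (elim exE conjE)
      show "v \<in> insert x z"
      proof (cases "v \<in> {a, b, c}")
        case True
        have "(v, y) \<in> r"
          using trans[OF v(2) y(2)] .
        then have "v = y"
          using True y(1) antichain by auto
        then have "u = y"
          using anti y(2) v(2) by blast
        then show ?thesis
          using y \<open>v = y\<close> by blast
      next
        case False
        have "v \<in> down y"
          using trans[OF v(2) y(2)] v(1) by (simp add: down_def)
        with False y(1) show ?thesis
          by (auto simp: z_def)
      qed
    qed
    have notin: "a \<notin> z" "b \<notin> z" "c \<notin> z"
      by (simp_all add: z_def)
    show False
    proof (rule no_khovanskii_cube[OF closed comp khov, of "insert a z" "insert b z" "insert c z" z])
      show "insert a z \<in> poset_ideals P r" "insert b z \<in> poset_ideals P r" "insert c z \<in> poset_ideals P r"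
        using ideal by simp_all
    qed (use notin distinct in auto)
  qed
qed

theorem theorem1p1:
  fixes P :: "'a set" and r :: "'a rel"
  assumes "finite P" and "partial_order_on P r" and "card P \<ge> 2"
    and "ordinal_irreducible P r"
  defines "L \<equiv> poset_ideals P r"
  shows "((\<exists>ord. compatible_order TYPE('k::field) L ord \<and>
              khovanskii_basis ord (lattice_algebra L :: ('a set, 'k) mpoly set) (lattice_binomials L))
            \<longleftrightarrow> free_2p2_1p1p1 P r) \<and>
         (free_2p2_1p1p1 P r \<longleftrightarrow> is_generalized_snake L (relation_of (\<subseteq>) L))"
proof -
  let ?khovanskii = "\<exists>ord. compatible_order TYPE('k) L ord \<and>
      khovanskii_basis ord (lattice_algebra L :: ('a set, 'k) mpoly set) (lattice_binomials L)"
  have free: "free_2p2_1p1p1 P r" if ?khovanskii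
    using that unfolding L_def by (elim exE conjE) (rule khovanskii_imp_free[OF assms(2)])
  have snake: "is_generalized_snake L (relation_of (\<subseteq>) L)" if free_P: "free_2p2_1p1p1 P r"
  proof -
    obtain n where "card P = n + 2"
      using assms(3) by (metis add.commute le_Suc_ex)
    from ideals_snake_embedding[OF assms(1,2) this assms(4) free_imp_no_two_chains[OF assms(2) free_P]
        free_imp_no_antichain[OF assms(2) free_P]]
    obtain f w where "snake_embedding f L w"
      unfolding L_def by blast
    then show ?thesis by (rule snake_embedding_imp_generalized_snake)
  qed
  have khov: ?khovanskii if "is_generalized_snake L (relation_of (\<subseteq>) L)"
  proof -
    have sub: "\<alpha> \<subseteq> P" if "\<alpha> \<in> L" for \<alpha>
      using that by (simp add: L_def poset_ideals_def)
    interpret narrow_lattice L "\<lambda>\<gamma>. (card P)\<^sup>2 - (card \<gamma>)\<^sup>2"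
    proof
      show "finite L"
        using sub assms(1) by (intro finite_subset[of L "Pow P"]) auto
      show "\<alpha> \<inter> \<beta> \<in> L" "\<alpha> \<union> \<beta> \<in> L" if "\<alpha> \<in> L" "\<beta> \<in> L" for \<alpha> \<beta>
        using that unfolding L_def by (rule poset_ideals_Int, rule poset_ideals_Un)
      show "(card P)\<^sup>2 - (card (\<alpha> \<inter> \<beta>))\<^sup>2 + ((card P)\<^sup>2 - (card (\<alpha> \<union> \<beta>))\<^sup>2)
          < (card P)\<^sup>2 - (card \<alpha>)\<^sup>2 + ((card P)\<^sup>2 - (card \<beta>)\<^sup>2)"
        if "\<alpha> \<in> L" "\<beta> \<in> L" "incomparable \<alpha> \<beta>" for \<alpha> \<beta>
        using square_card_decreases[OF assms(1) sub[OF that(1)] sub[OF that(2)] that(3)] .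
      show "\<not> incomparable \<beta> \<gamma>" if "\<alpha> \<in> L" "\<beta> \<in> L" "\<gamma> \<in> L" "incomparable \<alpha> \<beta>" "incomparable \<alpha> \<gamma>" for \<alpha> \<beta> \<gamma>
        using generalized_snake_width_two[OF \<open>is_generalized_snake L (relation_of (\<subseteq>) L)\<close> that] .
    qed
    show ?thesis by (rule ex_khovanskii_basis)
  qed
  show ?thesis
    by (intro conjI iffI) (fact free, fact khov[OF snake], fact snake, fact free[OF khov])
qed

end
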